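(* Let $\mathbb W$, $C$ and $G$ be as in the context, and suppose there exists a prime $p\equiv 3\pmod 4$ dividing $m_i$ for some $1\le i\le l$. Then there is a subgroup $D\le C$ with $D\cap\langle\widehat{w_1}\rangle=1$ and $C=D\langle\widehat{w_1}\rangle$; for any such $D$ the short exact sequence $1\to\operatorname{Inn}(\mathbb W)\to\operatorname{Inn}(\mathbb W)C\to\operatorname{Inn}(\mathbb W)C/\operatorname{Inn}(\mathbb W)\to 1$ splits with $\operatorname{Inn}(\mathbb W)C=\operatorname{Inn}(\mathbb W)\rtimes D$, and $$\operatorname{Aut}(\mathbb W)=\big(\operatorname{Inn}(\mathbb W)\rtimes D\big)\rtimes G.$$
   Context: Fix an integer $n\ge 3$, pairwise distinct odd integers $m_1,\dots,m_l\ge 3$ and positive integers $k_1,\dots,k_l$ with $k_1+\cdots+k_l=n-1$. Partition $\{2,\dots,n\}$ into consecutive blocks $A_1=\{2,\dots,k_1+1\}$, $A_2=\{k_1+2,\dots,k_1+k_2+1\}$, …, $A_l$ (of sizes $k_1,\dots,k_l$), and put $t_i=m_j$ for $i\in A_j$. The star group is $\mathbb W=\langle w_1,\dots,w_n\mid w_j^2=1\ (1\le j\le n),\ (w_1w_i)^{t_i}=1\ (2\le i\le n)\rangle$. For $2\le i\le n$ and $1\le k<t_i$ with $\gcd(k,t_i)=1$, $\theta_i^k$ is the automorphism of $\mathbb W$ with $\theta_i^k(w_j)=w_j$ for $j\ne i$ and $\theta_i^k(w_i)=w_1(w_1w_i)^k$. Let $C_i=\langle\theta_i^k : 1\le k<t_i,\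 \gcd(k,t_i)=1\rangle\cong \operatorname{U}_{t_i}$ and $C=C_2\times\cdots\times C_n\le\operatorname{Aut}(\mathbb W)$. $\widehat{w_1}$ is the inner automorphism $x\mapsto w_1xw_1$. $G$ is the group of graph automorphisms: the automorphisms $\tilde\alpha$ of $\mathbb W$ with $\tilde\alpha(w_1)=w_1$ and $\tilde\alpha(w_i)=w_{\alpha(i)}$ ($2\le i\le n$), where $\alpha$ ranges over permutations of $\{2,\dots,n\}$ with $\alpha(A_j)=A_j$ for all $j$. *)

theory Defs
  imports "HOL-Algebra.Algebra" "HOL-Computational_Algebra.Primes"
begin

text \<open>Blocks A_j (1 \<le> j \<le> l) partitioning {2..n} consecutively, of sizes k_1,...,k_l.\<close>
definition block :: "(nat \<Rightarrow> nat) \<Rightarrow> nat \<Rightarrow> nat set" where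
  "block k j = {2 + (\<Sum>r\<in>{1..<j}. k r) .. 1 + (\<Sum>r\<in>{1..j}. k r)}"

text \<open>t_i = m_j for i in A_j.\<close>
definition tval :: "nat \<Rightarrow> (nat \<Rightarrow> nat) \<Rightarrow> (nat \<Rightarrow> nat) \<Rightarrow> nat \<Rightarrow> nat" where
  "tval l m k i = m (THE j. j \<in> {1..l} \<and> i \<in> block k j)"

text \<open>The star group W given by the presentation
  < w_1..w_n | w_j^2 = 1, (w_1 w_i)^(t_i) = 1 >, realised as words over {1..n}
  modulo the congruence generated by the relators.\<close>
definition relators :: "nat \<Rightarrow> (nat \<Rightarrow> nat) \<Rightarrow> nat list set" where
  "relators n t = {[a, a] | a. a \<in> {1..n}} \<union>
                  {concat (replicate (t i) [1, i]) | i. i \<in> {2..n}}"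

definition red_step :: "nat \<Rightarrow> (nat \<Rightarrow> nat) \<Rightarrow> (nat list \<times> nat list) set" where
  "red_step n t = {(xs @ r @ ys, xs @ ys) | xs r ys. r \<in> relators n t}"

definition words :: "nat \<Rightarrow> nat list set" where
  "words n = lists {1..n}"

definition weq :: "nat \<Rightarrow> (nat \<Rightarrow> nat) \<Rightarrow> (nat list \<times> nat list) set" where
  "weq n t = Restr ((red_step n t \<union> (red_step n t)\<inverse>)\<^sup>*) (words n)"

definition starW :: "nat \<Rightarrow> (nat \<Rightarrow> nat) \<Rightarrow> nat list set monoid" where
  "starW n t = \<lparr> carrier = words n // weq n t,
                 monoid.mult = (\<lambda>A B. weq n t `` {(SOME a. a \<in> A) @ (SOME b. b \<in> B)}),
                 monoid.one = weq n t `` {[]} \<rparr>"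

definition gen :: "nat \<Rightarrow> (nat \<Rightarrow> nat) \<Rightarrow> nat \<Rightarrow> nat list set" where
  "gen n t j = weq n t `` {[j]}"

text \<open>Aut(W) (HOL-Algebra's automorphism group, extensional functions on the carrier).\<close>
abbreviation AutW :: "nat \<Rightarrow> (nat \<Rightarrow> nat) \<Rightarrow> (nat list set \<Rightarrow> nat list set) monoid" where
  "AutW n t \<equiv> AutoGroup (starW n t)"

text \<open>Inner automorphism x \<mapsto> g x g^{-1}.\<close>
definition innaut :: "('a, 'b) monoid_scheme \<Rightarrow> 'a \<Rightarrow> ('a \<Rightarrow> 'a)" where
  "innaut G g = (\<lambda>x \<in> carrier G. g \<otimes>\<^bsub>G\<^esub> x \<otimes>\<^bsub>G\<^esub> inv\<^bsub>G\<^esub> g)"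

definition Inn :: "('a, 'b) monoid_scheme \<Rightarrow> ('a \<Rightarrow> 'a) set" where
  "Inn G = innaut G ` carrier G"

text \<open>theta_i^k: the automorphism fixing w_j (j \<noteq> i) and sending w_i to w_1 (w_1 w_i)^k.\<close>
definition theta :: "nat \<Rightarrow> (nat \<Rightarrow> nat) \<Rightarrow> nat \<Rightarrow> nat \<Rightarrow> (nat list set \<Rightarrow> nat list set)" where
  "theta n t i k = (THE \<phi>. \<phi> \<in> auto (starW n t) \<and>
     (\<forall>j\<in>{1..n}. \<phi> (gen n t j) =
        (if j = i then gen n t 1 \<otimes>\<^bsub>starW n t\<^esub>
                       (gen n t 1 \<otimes>\<^bsub>starW n t\<^esub> gen n t i) [^]\<^bsub>starW n t\<^esub> k
         else gen n t j)))"

text \<open>C = C_2 \<times> ... \<times> C_n, the subgroup of Aut(W) generated by all theta_i^k.\<close>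
definition Cgrp :: "nat \<Rightarrow> (nat \<Rightarrow> nat) \<Rightarrow> (nat list set \<Rightarrow> nat list set) set" where
  "Cgrp n t = generate (AutW n t)
     {theta n t i k | i k. i \<in> {2..n} \<and> 1 \<le> k \<and> k < t i \<and> coprime k (t i)}"

text \<open>Group of graph automorphisms.\<close>
definition Ggrp :: "nat \<Rightarrow> (nat \<Rightarrow> nat) \<Rightarrow> nat \<Rightarrow> (nat \<Rightarrow> nat) \<Rightarrow> (nat list set \<Rightarrow> nat list set) set" where
  "Ggrp n t l k = {\<phi> \<in> auto (starW n t). \<phi> (gen n t 1) = gen n t 1 \<and>
     (\<exists>\<alpha>. bij_betw \<alpha> {2..n} {2..n} \<and> (\<forall>j\<in>{1..l}. \<alpha> ` block k j = block k j) \<and>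
          (\<forall>i\<in>{2..n}. \<phi> (gen n t i) = gen n t (\<alpha> i)))}"

end

(* Put a_i = w_1 w_i. Then W is the semidirect product of K, the free product of the cyclic groups
   <a_i> of order t_i, with <w_1>, which inverts every a_i; so each element is uniquely x or x w_1
   with x a reduced word in the a_i. As the t_i are odd, comparing a reduced word with its reversal
   and its negation shows that every involution is conjugate to w_1, that the centralizer of w_1 is
   {1, w_1}, and that every torsion element inverted by w_1 is a power of a single a_i.
   After an inner correction an automorphism fixes w_1, hence sends each a_i to a power of some a_j;
   comparing orders and using the inverse automorphism, it is an element of C times a graph
   automorphism. An inner automorphism fixing w_1 is trivial or conjugation by w_1, which gives the
   remaining intersections. A complement D is the kernel of the quadratic character modulo p of the
   exponent at one a_j with p dividing t_j, as -1 is not a square modulo p. *)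

theory Submission
  imports Defs "HOL-Number_Theory.Residues"
begin

section \<open>The group of words\<close>

text \<open>Uniqueness of normal forms is obtained by van der Waerden's method: words act on normal
  forms, every relator acts trivially, so equal words act equally, and the word spelled out by a
  normal form carries the empty one to it. The locale \<open>star_group\<close> then retains only
  the relations, generation, uniqueness and the universal property, and the study of automorphisms
  starts from these.

  C is given by generators and G by block permutations. Both are replaced by intrinsic descriptions
  inside the stabilizer of w_1: automorphisms sending every a_i to a power of itself, and
  automorphisms mapping each of w_2, ..., w_n to one of these generators.

  Conjugation by w_1 inverts every a_i, so it lies in C as well as in Inn(W). Because of this
  overlap C is not a complement of Inn(W) in Inn(W)C, and a subgroup D avoiding it has to be split
  off first. On C the overlap is the element -1 in every unit group, so a character of C with values
  1 and -1 that is nontrivial there is enough.\<close>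

lemma relators_words: "r \<in> relators n t \<Longrightarrow> 1 \<le> n \<Longrightarrow> r \<in> words n"
  by (auto simp: relators_def words_def split: if_splits)

text \<open>\<open>weq\<close> restricts a closure taken over all lists. Since this holds in both
  directions, a chain of steps that starts in \<open>words n\<close> never leaves it.\<close>

lemma red_step_words:
  assumes "(u, v) \<in> red_step n t" "1 \<le> n"
  shows "u \<in> words n \<longleftrightarrow> v \<in> words n"
proof -
  obtain xs r ys where "u = xs @ r @ ys" "v = xs @ ys" "r \<in> relators n t"
    using assms(1) by (auto simp: red_step_def)
  then show ?thesis using relators_words[of r n t] assms(2) by (auto simp: words_def)
qed

lemma red_step_append:
  "(u, v) \<in> red_step n t \<Longrightarrow> (xs @ u @ ys, xs @ v @ ys) \<in> red_step n t"
  unfolding red_step_def by clarsimp (metis append.assoc)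

lemma weq_equiv: "equiv (words n) (weq n t)"
proof -
  have "sym ((red_step n t \<union> (red_step n t)\<inverse>)\<^sup>*)"
    by (rule sym_rtrancl) (auto simp: sym_def)
  then show ?thesis
    unfolding weq_def equiv_def refl_on_def sym_def trans_def by (auto intro: rtrancl_trans)
qed

lemma weq_context:
  assumes "(u, v) \<in> weq n t" "xs \<in> words n" "ys \<in> words n"
  shows "(xs @ u @ ys, xs @ v @ ys) \<in> weq n t"
proof -
  have "(xs @ u @ ys, xs @ v @ ys) \<in> (red_step n t \<union> (red_step n t)\<inverse>)\<^sup>*"
    if "(u, v) \<in> (red_step n t \<union> (red_step n t)\<inverse>)\<^sup>*"
    using that
  proof induction
    case (step v w)
    then have "(xs @ v @ ys, xs @ w @ ys) \<in> red_step n t \<union> (red_step n t)\<inverse>"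
      using red_step_append by blast
    then show ?case using step.IH by (rule rtrancl_into_rtrancl[rotated])
  qed simp
  then show ?thesis using assms by (auto simp: weq_def words_def)
qed

lemma weq_append:
  assumes "(u, u') \<in> weq n t" "(v, v') \<in> weq n t"
  shows "(u @ v, u' @ v') \<in> weq n t"
proof -
  have w: "u \<in> words n" "v \<in> words n" "u' \<in> words n" "v' \<in> words n" "[] \<in> words n"
    using assms by (auto simp: weq_def words_def)
  have "(u @ v, u' @ v) \<in> weq n t" using weq_context[OF assms(1), of "[]" v] w by simp
  moreover have "(u' @ v, u' @ v') \<in> weq n t" using weq_context[OF assms(2), of u' "[]"] w by simp
  ultimately show ?thesis using weq_equiv[of n t] by (meson equivE transE)
qed

lemma weq_relator: "r \<in> relators n t \<Longrightarrow> 1 \<le> n \<Longrightarrow> (r, []) \<in> weq n t"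
proof -
  assume r: "r \<in> relators n t" "1 \<le> n"
  then have "(r, []) \<in> red_step n t"
    unfolding red_step_def by (auto intro!: exI[of _ "[]"])
  then show ?thesis using relators_words[OF r] by (auto simp: weq_def words_def)
qed

abbreviation cls :: "nat \<Rightarrow> (nat \<Rightarrow> nat) \<Rightarrow> nat list \<Rightarrow> nat list set" where
  "cls n t u \<equiv> weq n t `` {u}"

lemma cls_eq_iff: "u \<in> words n \<Longrightarrow> v \<in> words n \<Longrightarrow> cls n t u = cls n t v \<longleftrightarrow> (u, v) \<in> weq n t"
  by (rule eq_equiv_class_iff[OF weq_equiv])

lemma cls_closed: "u \<in> words n \<Longrightarrow> cls n t u \<in> carrier (starW n t)"
  by (auto simp: starW_def quotient_def)

lemma carrier_starW_E:
  assumes "A \<in> carrier (starW n t)"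
  obtains u where "u \<in> words n" "A = cls n t u"
  using assms by (auto simp: starW_def quotient_def)

lemma some_cls:
  assumes "u \<in> words n"
  shows "(u, SOME a. a \<in> cls n t u) \<in> weq n t" "(SOME a. a \<in> cls n t u) \<in> words n"
proof -
  have "u \<in> cls n t u" using assms weq_equiv[of n t] by (meson equiv_class_self)
  then have "(SOME a. a \<in> cls n t u) \<in> cls n t u" by (rule someI)
  then show "(u, SOME a. a \<in> cls n t u) \<in> weq n t" "(SOME a. a \<in> cls n t u) \<in> words n"
    by (auto simp: weq_def)
qed

text \<open>The product in \<open>starW\<close> goes through chosen representatives; compatibility
  of \<open>weq\<close> with concatenation makes the choice immaterial.\<close>

lemma cls_mult:
  assumes "u \<in> words n" "v \<in> words n"
  shows "cls n t u \<otimes>\<^bsub>starW n t\<^esub> cls n t v = cls n t (u @ v)"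
proof -
  have "(u @ v, (SOME a. a \<in> cls n t u) @ (SOME a. a \<in> cls n t v)) \<in> weq n t"
    using assms by (intro weq_append some_cls)
  then show ?thesis
    using equiv_class_eq[OF weq_equiv] by (fastforce simp: starW_def)
qed

lemma one_starW: "\<one>\<^bsub>starW n t\<^esub> = cls n t []"
  by (simp add: starW_def)

text \<open>Generators are their own inverses, so the reversed word is the inverse; letters cancel
  from the middle outwards.\<close>

lemma weq_rev_append:
  assumes "u \<in> words n" "1 \<le> n"
  shows "(rev u @ u, []) \<in> weq n t"
  using assms
proof (induction u)
  case Nil
  then show ?case by (simp add: weq_def words_def)
next
  case (Cons a u)
  then have u: "u \<in> words n" and a: "[a, a] \<in> relators n t"
    by (auto simp: words_def relators_def)
  have "(rev u @ [a, a] @ u, rev u @ [] @ u) \<in> weq n t"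
    using u weq_relator[OF a \<open>1 \<le> n\<close>] by (intro weq_context) (auto simp: words_def)
  then show ?case
    using Cons.IH[OF u \<open>1 \<le> n\<close>] weq_equiv[of n t] by (auto elim!: equivE dest: transD)
qed

lemma group_starW:
  assumes "1 \<le> n"
  shows "group (starW n t)"
proof (rule groupI)
  fix x y assume "x \<in> carrier (starW n t)" "y \<in> carrier (starW n t)"
  then obtain u v where uv: "u \<in> words n" "x = cls n t u" "v \<in> words n" "y = cls n t v"
    by (metis carrier_starW_E)
  then show "x \<otimes>\<^bsub>starW n t\<^esub> y \<in> carrier (starW n t)"
    by (simp add: cls_mult) (rule cls_closed, simp add: words_def)
  fix z assume "z \<in> carrier (starW n t)"
  then obtain w where w: "w \<in> words n" "z = cls n t w" by (metis carrier_starW_E)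
  have "u @ v \<in> words n" "v @ w \<in> words n" using uv w by (auto simp: words_def)
  then show "x \<otimes>\<^bsub>starW n t\<^esub> y \<otimes>\<^bsub>starW n t\<^esub> z = x \<otimes>\<^bsub>starW n t\<^esub> (y \<otimes>\<^bsub>starW n t\<^esub> z)"
    using uv w by (simp add: cls_mult)
next
  have n: "[] \<in> words n" by (simp add: words_def)
  then show "\<one>\<^bsub>starW n t\<^esub> \<in> carrier (starW n t)"
    unfolding one_starW by (rule cls_closed)
  fix x assume "x \<in> carrier (starW n t)"
  then obtain u where u: "u \<in> words n" "x = cls n t u" by (metis carrier_starW_E)
  then show "\<one>\<^bsub>starW n t\<^esub> \<otimes>\<^bsub>starW n t\<^esub> x = x" using n by (simp add: one_starW cls_mult)
  have r: "rev u \<in> words n" using u by (auto simp: words_def)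
  moreover have "cls n t (rev u @ u) = cls n t []"
    using weq_rev_append[OF u(1) assms] n u(1) r by (subst cls_eq_iff) (auto simp: words_def)
  ultimately show "\<exists>y\<in>carrier (starW n t). y \<otimes>\<^bsub>starW n t\<^esub> x = \<one>\<^bsub>starW n t\<^esub>"
    using u r by (intro bexI[of _ "cls n t (rev u)"]) (auto simp: cls_mult one_starW intro: cls_closed)
qed

section \<open>Reduced words\<close>

text \<open>Normal forms of the free product of the cyclic groups <a_i>: the pair (i, e) is the
  syllable a_i^e.\<close>

definition reduced :: "nat \<Rightarrow> (nat \<Rightarrow> nat) \<Rightarrow> (nat \<times> nat) list \<Rightarrow> bool" where
  "reduced n t xs \<longleftrightarrow>
     (\<forall>(i, e) \<in> set xs. i \<in> {2..n} \<and> 0 < e \<and> e < t i) \<and> distinct_adj (map fst xs)"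

text \<open>Conjugation by w_1 on normal forms: every a_i is inverted, the order of the syllables
  stays.\<close>

definition neg :: "(nat \<Rightarrow> nat) \<Rightarrow> (nat \<times> nat) list \<Rightarrow> (nat \<times> nat) list" where
  "neg t = map (\<lambda>(i, e). (i, t i - e))"

text \<open>Left multiplication by a_i on normal forms.\<close>

fun mulA :: "(nat \<Rightarrow> nat) \<Rightarrow> nat \<Rightarrow> (nat \<times> nat) list \<Rightarrow> (nat \<times> nat) list" where
  "mulA t i [] = [(i, 1)]"
| "mulA t i ((j, e) # xs) =
     (if j = i then (if Suc e = t i then xs else (i, Suc e) # xs) else (i, 1) # (j, e) # xs)"

lemma neg_simps [simp]:
  "neg t [] = []" "neg t ((i, e) # xs) = (i, t i - e) # neg t xs"
  "neg t (xs @ ys) = neg t xs @ neg t ys" "neg t (rev xs) = rev (neg t xs)"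
  "length (neg t xs) = length xs"
  by (auto simp: neg_def rev_map)

lemma map_fst_neg [simp]: "map fst (neg t xs) = map fst xs"
  by (auto simp: neg_def)

lemma reduced_Nil [simp]: "reduced n t []"
  by (simp add: reduced_def)

lemma reduced_Cons:
  "reduced n t ((i, e) # xs) \<longleftrightarrow>
     i \<in> {2..n} \<and> 0 < e \<and> e < t i \<and> reduced n t xs \<and> (xs = [] \<or> fst (hd xs) \<noteq> i)"
  by (cases xs) (auto simp: reduced_def)

lemma reduced_rev [simp]: "reduced n t (rev xs) \<longleftrightarrow> reduced n t xs"
  by (simp add: reduced_def flip: rev_map)

lemma reduced_neg: "reduced n t xs \<Longrightarrow> reduced n t (neg t xs)"
  unfolding reduced_def map_fst_neg by (auto simp: neg_def)

lemma neg_neg: "reduced n t xs \<Longrightarrow> neg t (neg t xs) = xs"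
  by (induction xs) (auto simp: reduced_Cons)

lemma reduced_mulA: "reduced n t xs \<Longrightarrow> i \<in> {2..n} \<Longrightarrow> 1 < t i \<Longrightarrow> reduced n t (mulA t i xs)"
  by (cases "(t, i, xs)" rule: mulA.cases) (auto simp: reduced_Cons)

text \<open>This is w_i^2 = 1 on normal forms: for the element x of \<open>xs\<close> it reads a_i
  (w_1 a_i x w_1) = w_1 x w_1.\<close>

lemma mulA_neg_mulA:
  "reduced n t xs \<Longrightarrow> 1 < t i \<Longrightarrow> mulA t i (neg t (mulA t i xs)) = neg t xs"
proof (cases "(t, i, xs)" rule: mulA.cases)
  case (2 t' i' j e ys)
  assume "reduced n t xs" "1 < t i"
  then show ?thesis using 2 by (cases ys) (auto simp: reduced_Cons)
qed simp

lemma mulA_power: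
  assumes "xs = [] \<or> fst (hd xs) \<noteq> i" "0 < e" "e < t i"
  shows "(mulA t i ^^ e) xs = (i, e) # xs"
  using assms(2,3)
proof (induction e)
  case (Suc e)
  then show ?case using assms(1) by (cases "e = 0"; cases "(t, i, xs)" rule: mulA.cases) auto
qed simp

lemma mulA_power_order:
  assumes "reduced n t xs" "1 < t i"
  shows "(mulA t i ^^ t i) xs = xs"
proof -
  \<comment> \<open>The first t_i - 1 applications build up the syllable (i, t_i - 1), the last one
    deletes it.\<close>
  have *: "(mulA t i ^^ t i) ys = ys" if "ys = [] \<or> fst (hd ys) \<noteq> i" for ys
  proof -
    obtain e where e: "t i = Suc e" "0 < e" using assms(2) by (cases "t i") auto
    then have "(mulA t i ^^ e) ys = (i, e) # ys" using mulA_power[OF that, of e t] by simp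
    then show ?thesis using e by simp
  qed
  show ?thesis
  proof (cases "xs = [] \<or> fst (hd xs) \<noteq> i")
    case False
    then obtain e ys where xs: "xs = (i, e) # ys" by (cases xs) auto
    with assms have ys: "ys = [] \<or> fst (hd ys) \<noteq> i" and e: "0 < e" "e < t i"
      by (auto simp: reduced_Cons)
    \<comment> \<open>The first syllable itself comes from e applications to \<open>ys\<close>, and
      these commute with the t_i further ones.\<close>
    have eq: "xs = (mulA t i ^^ e) ys" using mulA_power[where t = t, OF ys e] xs by simp
    then have "(mulA t i ^^ t i) xs = (mulA t i ^^ (t i + e)) ys"
      by (simp only: funpow_add comp_apply)
    also have "\<dots> = (mulA t i ^^ e) ((mulA t i ^^ t i) ys)"
      by (simp only: add.commute[of "t i"] funpow_add comp_apply)
    finally show ?thesis using *[OF ys] eq by simp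
  qed (rule *)
qed

text \<open>The pair (xs, b) stands for x w_1^b. Pushing w_1 to the right through x negates x and
  toggles b; the other generators are w_j = w_1 a_j.\<close>

fun act :: "(nat \<Rightarrow> nat) \<Rightarrow> nat \<Rightarrow> (nat \<times> nat) list \<times> bool \<Rightarrow> (nat \<times> nat) list \<times> bool" where
  "act t j (xs, b) = (neg t (if j = 1 then xs else mulA t j xs), \<not> b)"

lemma act_one_act:
  assumes "reduced n t xs" "i \<in> {2..n}" "1 < t i"
  shows "act t 1 (act t i (xs, b)) = (mulA t i xs, b)"
  using assms neg_neg[OF reduced_mulA] by auto

lemma foldr_replicate_pair:
  assumes "reduced n t xs" "i \<in> {2..n}" "1 < t i"
  shows "foldr (act t) (concat (replicate e [1, i])) (xs, b) = ((mulA t i ^^ e) xs, b)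
    \<and> reduced n t ((mulA t i ^^ e) xs)"
proof (induction e)
  case (Suc e)
  then show ?case
    using assms act_one_act[of n t "(mulA t i ^^ e) xs" i b] reduced_mulA[of n t "(mulA t i ^^ e) xs" i]
    by (simp del: act.simps)
qed (use assms in simp)

text \<open>Squares of generators act trivially by \<open>neg_neg\<close> and
  \<open>mulA_neg_mulA\<close>; the long relators act as the t_i-th power of left multiplication by
  a_i.\<close>

lemma act_relator:
  assumes "r \<in> relators n t" "\<And>i. i \<in> {2..n} \<Longrightarrow> 1 < t i" "reduced n t xs"
  shows "foldr (act t) r (xs, b) = (xs, b)"
proof -
  consider a where "a \<in> {1..n}" "r = [a, a]"
    | i where "i \<in> {2..n}" "r = concat (replicate (t i) [1, i])"
    using assms(1) by (auto simp: relators_def)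
  then show ?thesis
  proof cases
    case 1
    show ?thesis
    proof (cases "a = 1")
      case False
      then have "1 < t a" using 1 assms(2) by auto
      then show ?thesis using False 1 assms(3) mulA_neg_mulA neg_neg by fastforce
    qed (use 1 assms neg_neg in auto)
  next
    case 2
    then show ?thesis
      using foldr_replicate_pair[OF assms(3) 2(1) assms(2), of "t i"] mulA_power_order assms by metis
  qed
qed

lemma reduced_act:
  assumes "u \<in> words n" "\<And>i. i \<in> {2..n} \<Longrightarrow> 1 < t i" "reduced n t (fst s)"
  shows "reduced n t (fst (foldr (act t) u s))"
  using assms(1)
proof (induction u)
  case (Cons a u)
  then obtain xs b where s: "foldr (act t) u s = (xs, b)" "reduced n t xs"
    by (metis (no_types, lifting) Cons_in_lists_iff prod.collapse words_def)
  have "a = 1 \<or> a \<in> {2..n}" using Cons by (auto simp: words_def)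
  then show ?case using s reduced_mulA[OF s(2)] assms(2) by (auto intro!: reduced_neg)
qed (use assms in simp)

lemma act_red_step:
  assumes "(u, v) \<in> red_step n t" "u \<in> words n" "\<And>i. i \<in> {2..n} \<Longrightarrow> 1 < t i"
    "reduced n t (fst s)"
  shows "foldr (act t) u s = foldr (act t) v s"
proof -
  obtain xs r ys where *: "u = xs @ r @ ys" "v = xs @ ys" "r \<in> relators n t"
    using assms(1) by (auto simp: red_step_def)
  have "ys \<in> words n" using assms(2) * by (auto simp: words_def)
  then have "reduced n t (fst (foldr (act t) ys s))" by (rule reduced_act) fact+
  then have "foldr (act t) r (foldr (act t) ys s) = foldr (act t) ys s"
    using act_relator[OF *(3) assms(3)] by (metis prod.collapse)
  then show ?thesis using * by simp
qed

lemma act_weq: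
  assumes "(u, v) \<in> weq n t" "1 \<le> n" "\<And>i. i \<in> {2..n} \<Longrightarrow> 1 < t i" "reduced n t (fst s)"
  shows "foldr (act t) u s = foldr (act t) v s"
proof -
  have "(u, v) \<in> (red_step n t \<union> (red_step n t)\<inverse>)\<^sup>*" and u: "u \<in> words n"
    using assms(1) by (auto simp: weq_def)
  then have "v \<in> words n \<and> foldr (act t) u s = foldr (act t) v s"
  proof induction
    case (step v w)
    then have "w \<in> words n" using red_step_words[of _ _ n t] assms(2) by blast
    then show ?case using step act_red_step[OF _ _ assms(3,4)] by (metis Un_iff converseD)
  qed (use u in simp)
  then show ?thesis by simp
qed

declare One_nat_def [simp del]

section \<open>Normal forms in a group with the properties of W\<close>

definition syl_prod :: "('a, 'b) monoid_scheme \<Rightarrow> (nat \<Rightarrow> 'a) \<Rightarrow> (nat \<times> nat) list \<Rightarrow> 'a" where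
  "syl_prod G w xs = foldr (\<lambda>(i, e) g. (w 1 \<otimes>\<^bsub>G\<^esub> w i) [^]\<^bsub>G\<^esub> e \<otimes>\<^bsub>G\<^esub> g) xs \<one>\<^bsub>G\<^esub>"

lemma syl_prod_simps [simp]:
  "syl_prod G w [] = \<one>\<^bsub>G\<^esub>"
  "syl_prod G w ((i, e) # xs) = (w 1 \<otimes>\<^bsub>G\<^esub> w i) [^]\<^bsub>G\<^esub> e \<otimes>\<^bsub>G\<^esub> syl_prod G w xs"
  by (simp_all add: syl_prod_def)

lemma reduced_append:
  "reduced n t (xs @ ys) \<longleftrightarrow> reduced n t xs \<and> reduced n t ys \<and>
     (xs = [] \<or> ys = [] \<or> fst (last xs) \<noteq> fst (hd ys))"
  by (auto simp: reduced_def distinct_adj_append_iff last_map hd_map)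

text \<open>Applied to the identity for palindromes and to the negation of exponents for inverses.\<close>
lemma reduced_symmetric_middle:
  assumes "reduced n t xs" "rev (map f xs) = xs" "xs \<noteq> []" "\<And>c. fst (f c) = fst c"
  shows "\<exists>ys c. xs = ys @ [c] @ rev (map f ys) \<and> f c = c"
  using assms(1-3)
proof (induction xs rule: length_induct)
  case (1 xs)
  obtain x zs where xs: "xs = x # zs" using 1 by (cases xs) auto
  show ?case
  proof (cases zs rule: rev_cases)
    case Nil
    then show ?thesis using 1 xs by (intro exI[of _ "[]"]) auto
  next
    case (snoc us y)
    then have *: "f y = x" "f x = y" "rev (map f us) = us" using 1 xs by auto
    \<comment> \<open>An empty middle would make \<open>x\<close> and \<open>y = f x\<close>, which
      carry the same letter, adjacent. So a symmetric reduced word has odd length.\<close>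
    have "us \<noteq> []" using 1(2) * assms(4)[of x] xs snoc by (auto simp: reduced_def)
    moreover have "reduced n t us" using 1(2) unfolding xs snoc
      by (cases x) (simp add: reduced_Cons reduced_append)
    ultimately obtain ys c where "us = ys @ [c] @ rev (map f ys)" "f c = c"
      using 1(1)[rule_format, of us] * xs snoc by auto
    then show ?thesis using xs snoc * by (intro exI[of _ "x # ys"] exI[of _ c]) auto
  qed
qed

text \<open>\<open>gen_induct\<close> multiplies by generators only, as these are their own
  inverses. \<open>nf_unique\<close> is uniqueness of the form x w_1^b. \<open>universal\<close> has
  W as its target because it serves to construct endomorphisms.\<close>

locale star_group = group W for W (structure) +
  fixes n :: nat and t :: "nat \<Rightarrow> nat" and w :: "nat \<Rightarrow> 'a"
  assumes n_pos: "1 \<le> n"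
    and t_odd: "i \<in> {2..n} \<Longrightarrow> odd (t i)"
    and t_gt1: "i \<in> {2..n} \<Longrightarrow> 1 < t i"
    and w_closed [simp, intro]: "j \<in> {1..n} \<Longrightarrow> w j \<in> carrier W"
    and w_sq: "j \<in> {1..n} \<Longrightarrow> w j \<otimes> w j = \<one>"
    and w_rel: "i \<in> {2..n} \<Longrightarrow> (w 1 \<otimes> w i) [^] t i = \<one>"
    and gen_induct [consumes 1, case_names one mult]:
      "\<lbrakk>g \<in> carrier W; P \<one>;
        \<And>j g. \<lbrakk>j \<in> {1..n}; g \<in> carrier W; P g\<rbrakk> \<Longrightarrow> P (w j \<otimes> g)\<rbrakk> \<Longrightarrow> P g"
    and nf_unique:
      "\<lbrakk>reduced n t xs; reduced n t ys;
        syl_prod W w xs \<otimes> (if b then w 1 else \<one>) = syl_prod W w ys \<otimes> (if c then w 1 else \<one>)\<rbrakk>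
       \<Longrightarrow> xs = ys \<and> b = c"
    and universal:
      "\<lbrakk>\<And>j. j \<in> {1..n} \<Longrightarrow> v j \<in> carrier W \<and> v j \<otimes> v j = \<one>;
        \<And>i. i \<in> {2..n} \<Longrightarrow> (v 1 \<otimes> v i) [^] t i = \<one>\<rbrakk>
       \<Longrightarrow> \<exists>h \<in> hom W W. \<forall>j\<in>{1..n}. h (w j) = v j"
begin

abbreviation a :: "nat \<Rightarrow> 'a" where "a i \<equiv> w 1 \<otimes> w i"

abbreviation ev :: "(nat \<times> nat) list \<Rightarrow> 'a" where "ev \<equiv> syl_prod W w"

lemma w1_closed [simp, intro]: "w 1 \<in> carrier W"
  using w_closed[of 1] n_pos by auto

lemma w_closed2 [simp, intro]: "i \<in> {2..n} \<Longrightarrow> w i \<in> carrier W"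
  using w_closed[of i] by auto

lemma a_closed: "i \<in> {2..n} \<Longrightarrow> a i \<in> carrier W"
  by auto

lemma w1_sq: "w 1 \<otimes> w 1 = \<one>"
  using w_sq[of 1] n_pos by auto

lemma w1_cancel: "g \<in> carrier W \<Longrightarrow> w 1 \<otimes> (w 1 \<otimes> g) = g"
  using w1_sq by (simp flip: m_assoc)

lemma inv_w1: "inv (w 1) = w 1"
  using w1_sq by (intro inv_equality) auto

lemma inv_w: "j \<in> {1..n} \<Longrightarrow> inv (w j) = w j"
  using w_sq by (intro inv_equality) auto



lemma conj_hom: "(\<lambda>g. w 1 \<otimes> g \<otimes> w 1) \<in> hom W W"
proof (rule homI)
  fix x y assume xy: "x \<in> carrier W" "y \<in> carrier W"
  have "w 1 \<otimes> x \<otimes> w 1 \<otimes> (w 1 \<otimes> y \<otimes> w 1) = w 1 \<otimes> x \<otimes> (w 1 \<otimes> (w 1 \<otimes> (y \<otimes> w 1)))"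
    using xy by (simp add: m_assoc)
  also have "\<dots> = w 1 \<otimes> (x \<otimes> y) \<otimes> w 1"
    using xy by (simp only: w1_cancel m_closed w1_closed m_assoc)
  finally show "w 1 \<otimes> (x \<otimes> y) \<otimes> w 1 = w 1 \<otimes> x \<otimes> w 1 \<otimes> (w 1 \<otimes> y \<otimes> w 1)" by simp
qed auto

lemma conj_a: "i \<in> {2..n} \<Longrightarrow> w 1 \<otimes> a i \<otimes> w 1 = inv (a i)"
  by (simp add: w1_cancel inv_mult_group inv_w1 inv_w)

lemma a_pow_cong:
  assumes "i \<in> {2..n}" "[e = f] (mod t i)"
  shows "a i [^] e = a i [^] f"
proof -
  have *: "a i [^] e = a i [^] (e mod t i)" for e :: nat
  proof -
    have "a i [^] e = a i [^] (t i * (e div t i) + e mod t i)" by simp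
    also have "\<dots> = (a i [^] t i) [^] (e div t i) \<otimes> a i [^] (e mod t i)"
      using assms a_closed by (simp only: nat_pow_mult[symmetric] nat_pow_pow)
    finally show ?thesis using assms a_closed w_rel by simp
  qed
  show ?thesis using *[of e] *[of f] assms(2) by (simp add: cong_def)
qed

lemma inv_a_pow:
  assumes "i \<in> {2..n}" "e \<le> t i"
  shows "inv (a i [^] e) = a i [^] (t i - e)"
proof (rule inv_equality)
  show "a i [^] (t i - e) \<otimes> a i [^] e = \<one>"
    using assms w_rel a_closed by (simp only: nat_pow_mult) simp
qed (use assms a_closed in auto)

lemma hom_pow: "h \<in> hom W W \<Longrightarrow> x \<in> carrier W \<Longrightarrow> h (x [^] (e::nat)) = h x [^] e"
  by (simp add: hom_nat_pow is_group)

lemma conj_a_pow: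
  assumes "i \<in> {2..n}" "e \<le> t i"
  shows "w 1 \<otimes> a i [^] e \<otimes> w 1 = a i [^] (t i - e)"
proof -
  have "w 1 \<otimes> a i [^] e \<otimes> w 1 = inv (a i) [^] e"
    using hom_pow[OF conj_hom a_closed[OF assms(1)], of e] conj_a[OF assms(1)] by simp
  also have "\<dots> = inv (a i [^] e)" using assms a_closed by (simp add: nat_pow_inv)
  finally show ?thesis using inv_a_pow assms by simp
qed

lemma ev_closed [simp, intro]: "reduced n t xs \<Longrightarrow> ev xs \<in> carrier W"
  by (induction xs) (auto simp: reduced_Cons)

lemma ev_append: "reduced n t xs \<Longrightarrow> reduced n t ys \<Longrightarrow> ev (xs @ ys) = ev xs \<otimes> ev ys"
  by (induction xs) (auto simp: reduced_Cons m_assoc)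

lemma conj_ev:
  assumes "reduced n t xs"
  shows "w 1 \<otimes> ev xs \<otimes> w 1 = ev (neg t xs)"
  using assms
proof (induction xs)
  case (Cons c xs)
  obtain i e where c: "c = (i, e)" by fastforce
  then have *: "i \<in> {2..n}" "e < t i" "reduced n t xs" using Cons by (auto simp: reduced_Cons)
  have "w 1 \<otimes> (a i [^] e \<otimes> ev xs) \<otimes> w 1 = (w 1 \<otimes> a i [^] e \<otimes> w 1) \<otimes> (w 1 \<otimes> ev xs \<otimes> w 1)"
    by (rule hom_mult[OF conj_hom]) (use * a_closed in auto)
  then show ?case using Cons.IH * c conj_a_pow[of i e] by simp
qed (simp add: w1_sq)

lemma inv_ev:
  assumes "reduced n t xs"
  shows "inv (ev xs) = ev (rev (neg t xs))"
  using assms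
proof (induction xs)
  case (Cons c xs)
  obtain i e where c: "c = (i, e)" by fastforce
  then have *: "i \<in> {2..n}" "0 < e" "e < t i" "reduced n t xs" using Cons by (auto simp: reduced_Cons)
  have "inv (ev (c # xs)) = ev (rev (neg t xs)) \<otimes> a i [^] (t i - e)"
    using * Cons.IH c inv_a_pow[of i e] a_closed by (simp add: inv_mult_group)
  also have "\<dots> = ev (rev (neg t xs) @ [(i, t i - e)])"
    using * a_closed by (subst ev_append) (auto simp: reduced_Cons reduced_neg)
  finally show ?case using c by simp
qed simp

lemma ev_inj: "reduced n t xs \<Longrightarrow> reduced n t ys \<Longrightarrow> ev xs = ev ys \<Longrightarrow> xs = ys"
  using nf_unique[of xs ys False False] by simp

lemma ev_mulA:
  assumes "reduced n t xs" "i \<in> {2..n}"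
  shows "a i \<otimes> ev xs = ev (mulA t i xs)"
proof (cases "(t, i, xs)" rule: mulA.cases)
  case (1 t' i')
  then show ?thesis using assms a_closed by simp
next
  case (2 t' i' j e ys)
  have ys: "reduced n t ys" "j \<in> {2..n}" using assms 2 by (auto simp: reduced_Cons)
  show ?thesis
  proof (cases "j = i")
    case True
    have "a i \<otimes> (a i [^] e \<otimes> ev ys) = a i [^] Suc e \<otimes> ev ys"
      using assms(2) ys a_closed nat_pow_Suc2[of "a i" e] by (simp add: m_assoc)
    then have *: "a i \<otimes> ev xs = a i [^] Suc e \<otimes> ev ys" using 2 True by simp
    show ?thesis
    proof (cases "Suc e = t i")
      case eq: True
      then have "a i [^] Suc e = \<one>" using w_rel[OF assms(2)] by (simp only:)
      then show ?thesis using * eq True 2 ys by (simp del: nat_pow_Suc)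
    qed (use * True 2 in \<open>simp del: nat_pow_Suc\<close>)
  qed (use 2 assms a_closed in simp)
qed

lemma nf_exists:
  assumes "g \<in> carrier W"
  obtains xs b where "reduced n t xs" "g = ev xs \<otimes> (if b then w 1 else \<one>)"
proof -
  have "\<exists>xs b. reduced n t xs \<and> g = ev xs \<otimes> (if b then w 1 else \<one>)"
    using assms
  proof (induction rule: gen_induct)
    case one
    show ?case by (intro exI[of _ "[]"] exI[of _ False]) simp
  next
    case (mult j g)
    then obtain xs b where xs: "reduced n t xs" "g = ev xs \<otimes> (if b then w 1 else \<one>)" by blast
    \<comment> \<open>The identity behind \<open>act\<close>, now in W. It treats j = 1 directly and
      the other generators through w_j = w_1 a_j.\<close>
    have *: "w 1 \<otimes> (ev ys \<otimes> (if b then w 1 else \<one>)) = ev (neg t ys) \<otimes> (if \<not> b then w 1 else \<one>)"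
      if "reduced n t ys" for ys
    proof -
      have "ev (neg t ys) \<otimes> w 1 = w 1 \<otimes> ev ys"
        using that conj_ev[OF that] w1_sq by (metis ev_closed m_assoc m_closed r_one w1_closed)
      moreover have "ev (neg t ys) = w 1 \<otimes> (ev ys \<otimes> w 1)"
        using that conj_ev[OF that] by (simp add: m_assoc)
      ultimately show ?thesis using that by simp
    qed
    show ?case
    proof (cases "j = 1")
      case True
      then show ?thesis using xs *[OF xs(1)] reduced_neg by blast
    next
      case False
      then have j: "j \<in> {2..n}" using mult by auto
      have "w j \<otimes> g = w 1 \<otimes> (a j \<otimes> ev xs \<otimes> (if b then w 1 else \<one>))"
        using xs j w1_cancel by (simp add: m_assoc)
      also have "a j \<otimes> ev xs = ev (mulA t j xs)" using ev_mulA xs j by simp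
      finally show ?thesis
        using *[of "mulA t j xs"] reduced_mulA[OF xs(1) j t_gt1[OF j]] reduced_neg by metis
    qed
  qed
  then show ?thesis using that by blast
qed

lemma reduced_single: "i \<in> {2..n} \<Longrightarrow> 0 < e \<Longrightarrow> e < t i \<Longrightarrow> reduced n t [(i, e)]"
  by (simp add: reduced_Cons)

text \<open>A power of a_i has a normal form of at most one syllable, so different cyclic factors
  share only the identity; the second alternative is that case.\<close>

lemma a_pow_eq_iff:
  assumes "i \<in> {2..n}" "j \<in> {2..n}"
  shows "a i [^] e = a j [^] f \<longleftrightarrow> (i = j \<and> [e = f] (mod t i)) \<or> (t i dvd e \<and> t j dvd f)"
proof
  \<comment> \<open>A syllable with exponent 0 is not reduced, so trivial powers need the empty
    list.\<close>
  define nf where "nf = (\<lambda>i e. if t i dvd e then [] else [(i, e mod t i)])"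
  have nf: "reduced n t (nf i e)" "ev (nf i e) = a i [^] e" if "i \<in> {2..n}" for i e
  proof -
    show "reduced n t (nf i e)"
      using that t_gt1[OF that] by (auto simp: nf_def reduced_Cons dvd_eq_mod_eq_0)
    have "a i [^] e = a i [^] (e mod t i)"
      using that by (intro a_pow_cong) (auto simp: cong_def)
    then show "ev (nf i e) = a i [^] e"
      using that a_closed by (auto simp: nf_def dvd_eq_mod_eq_0)
  qed
  assume "a i [^] e = a j [^] f"
  then have "nf i e = nf j f" using nf assms ev_inj by metis
  then show "(i = j \<and> [e = f] (mod t i)) \<or> (t i dvd e \<and> t j dvd f)"
    by (auto simp: nf_def cong_def split: if_splits)
next
  assume "(i = j \<and> [e = f] (mod t i)) \<or> (t i dvd e \<and> t j dvd f)"
  then consider "i = j" "[e = f] (mod t i)" | "[e = 0] (mod t i)" "[f = 0] (mod t j)"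
    by (auto simp: cong_0_iff)
  then show "a i [^] e = a j [^] f"
    by cases (use assms a_pow_cong[of i e] a_pow_cong[of j f] in fastforce)+
qed

lemma a_pow_eq_one_iff: "i \<in> {2..n} \<Longrightarrow> a i [^] e = \<one> \<longleftrightarrow> t i dvd e"
  using a_pow_eq_iff[of i i e 0] by (auto simp: cong_0_iff)

lemma w1_neq_one: "w 1 \<noteq> \<one>"
  using nf_unique[of "[]" "[]" True False] by auto

section \<open>Involutions, the centralizer of w_1, and torsion inverted by w_1\<close>

lemma reduced_rev_neg:
  assumes "reduced n t xs" "rev (neg t xs) = xs"
  shows "xs = []"
proof (rule ccontr)
  assume "xs \<noteq> []"
  then obtain ys c where c: "xs = ys @ [c] @ rev (neg t ys)" "(\<lambda>(i, e). (i, t i - e)) c = c"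
    using reduced_symmetric_middle[of n t xs "\<lambda>(i, e). (i, t i - e)"] assms
    unfolding neg_def by (metis (no_types, lifting) case_prod_beta fst_conv)
  obtain i e where "c = (i, e)" by fastforce
  \<comment> \<open>The middle syllable is its own inverse: e = t_i - e.\<close>
  then have "i \<in> {2..n}" "t i = 2 * e" using c assms(1) by (auto simp: reduced_def)
  then show False using t_odd[of i] by simp
qed

lemma ev_involution:
  assumes "reduced n t xs" "ev xs \<otimes> ev xs = \<one>"
  shows "xs = []"
proof -
  have "ev xs = inv (ev xs)" using assms by (intro inv_equality[symmetric]) auto
  then have "ev (rev (neg t xs)) = ev xs" using inv_ev assms by simp
  then show ?thesis using assms reduced_rev_neg ev_inj reduced_neg by simp
qed

text \<open>Conjugation by w_1 negates, inversion reverses and negates, so together they only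
  reverse. By \<open>conj_w1_ev\<close> the hypothesis says that x w_1 squares to 1.\<close>

lemma palindrome_if_conj_inverse:
  assumes "reduced n t xs" "ev xs \<otimes> ev (neg t xs) = \<one>"
  shows "rev xs = xs"
proof -
  have "ev xs = inv (ev (neg t xs))" using assms reduced_neg by (metis ev_closed inv_equality)
  then have "ev xs = ev (rev xs)" using inv_ev[OF reduced_neg[OF assms(1)]] neg_neg assms by simp
  then show ?thesis using assms ev_inj[of xs "rev xs"] by simp
qed

lemma conj_w1_ev:
  "reduced n t xs \<Longrightarrow> ev xs \<otimes> w 1 \<otimes> (ev xs \<otimes> w 1) = ev xs \<otimes> ev (neg t xs)"
  using conj_ev[of xs] by (simp add: m_assoc)

text \<open>The exponents are odd, so the middle letter of a palindrome has a square root,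
  which makes the palindrome a twisted conjugate of the empty word.\<close>
lemma involution_conj_w1:
  assumes "g \<in> carrier W" "g \<otimes> g = \<one>" "g \<noteq> \<one>"
  shows "\<exists>z \<in> carrier W. g = z \<otimes> w 1 \<otimes> inv z"
proof -
  obtain xs b where xs: "reduced n t xs" "g = ev xs \<otimes> (if b then w 1 else \<one>)"
    using nf_exists assms by blast
  have b
  proof (rule ccontr)
    assume "\<not> b"
    then show False using xs assms ev_involution[of xs] by simp
  qed
  then have g: "g = ev xs \<otimes> w 1" using xs by simp
  have pal: "rev xs = xs"
    using palindrome_if_conj_inverse xs(1) assms(2) conj_w1_ev unfolding g by metis
  show ?thesis
  proof (cases "xs = []")
    case True
    then show ?thesis using g by (intro bexI[of _ \<one>]) auto
  next
    case False
    then obtain ys c where c: "xs = ys @ [c] @ rev ys"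
      using reduced_symmetric_middle[of n t xs id] xs(1) pal by auto
    obtain i e where ie: "c = (i, e)" by fastforce
    then have i: "i \<in> {2..n}" and ys: "reduced n t ys" and e: "0 < e" "e < t i"
      using xs(1) c by (auto simp: reduced_append reduced_Cons)
    \<comment> \<open>Halving modulo the odd number t_i: one of e and e + t_i is even.\<close>
    obtain f where f: "f \<le> t i" "[f + f = e] (mod t i)"
    proof (cases "even e")
      case True
      then show ?thesis using e by (intro that[of "e div 2"]) (auto simp flip: mult_2)
    next
      case False
      then have "(e + t i) div 2 + (e + t i) div 2 = e + t i"
        using t_odd[OF i] by (metis add_self_div_2 div_add_self1 even_add even_two_times_div_two mult_2)
      then show ?thesis using e by (intro that[of "(e + t i) div 2"]) (auto simp: cong_def)
    qed
    \<comment> \<open>In w_1 z^-1 w_1 the two negations cancel and only the reversal is left. Hence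
      z (w_1 z^-1 w_1) is \<open>ys\<close>, then a_i^(2f) = a_i^e, then \<open>rev ys\<close>,
      which is \<open>xs\<close>.\<close>
    define z where "z = ev ys \<otimes> a i [^] f"
    have z: "z \<in> carrier W" using ys i a_closed by (auto simp: z_def)
    have "w 1 \<otimes> inv z \<otimes> w 1 = (w 1 \<otimes> inv (a i [^] f) \<otimes> w 1) \<otimes> (w 1 \<otimes> inv (ev ys) \<otimes> w 1)"
      using hom_mult[OF conj_hom, of "inv (a i [^] f)" "inv (ev ys)"] ys i a_closed
      by (simp add: z_def inv_mult_group)
    also have "w 1 \<otimes> inv (ev ys) \<otimes> w 1 = ev (rev ys)"
      using conj_ev[of "rev (neg t ys)"] ys neg_neg[OF ys] reduced_neg[OF ys] by (simp add: inv_ev)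
    also have "w 1 \<otimes> inv (a i [^] f) \<otimes> w 1 = a i [^] f"
      using conj_a_pow[OF i, of "t i - f"] f by (simp add: inv_a_pow[OF i])
    finally have "z \<otimes> (w 1 \<otimes> inv z \<otimes> w 1) = ev ys \<otimes> (a i [^] (f + f) \<otimes> ev (rev ys))"
      using ys i a_closed by (simp add: z_def m_assoc nat_pow_mult[symmetric])
    also have "\<dots> = ev xs"
      using a_pow_cong[OF i f(2)] xs(1) ys unfolding c ie
      by (subst ev_append) (auto simp: reduced_append)
    finally have "g = z \<otimes> (w 1 \<otimes> inv z \<otimes> w 1) \<otimes> w 1" using g by simp
    also have "\<dots> = z \<otimes> (w 1 \<otimes> inv z \<otimes> (w 1 \<otimes> w 1))" using z by (simp add: m_assoc)
    also have "\<dots> = z \<otimes> w 1 \<otimes> inv z" using z w1_sq by (simp add: m_assoc)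
    finally show ?thesis using z by blast
  qed
qed

text \<open>A nonempty normal form fixed by negation has t_i = 2e at its first syllable, against the
  parity of t_i. The factor w_1^b commutes with w_1 and stays undetermined.\<close>

lemma centralizer_w1:
  assumes "g \<in> carrier W" "w 1 \<otimes> g \<otimes> w 1 = g"
  shows "g = \<one> \<or> g = w 1"
proof -
  obtain xs b where xs: "reduced n t xs" "g = ev xs \<otimes> (if b then w 1 else \<one>)"
    using nf_exists assms by blast
  have "w 1 \<otimes> g \<otimes> w 1 = w 1 \<otimes> ev xs \<otimes> w 1 \<otimes> (if b then w 1 else \<one>)"
    using xs by (auto simp: m_assoc)
  then have "ev (neg t xs) \<otimes> (if b then w 1 else \<one>) = ev xs \<otimes> (if b then w 1 else \<one>)"
    using xs assms(2) conj_ev by metis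
  then have neg: "neg t xs = xs" using nf_unique[of "neg t xs" xs b b] xs reduced_neg by auto
  have "xs = []"
  proof (cases xs)
    case (Cons c ys)
    then obtain i e where "c = (i, e)" "i \<in> {2..n}" "t i - e = e" "e < t i"
      using neg xs(1) by (cases c) (auto simp: reduced_Cons)
    then have "i \<in> {2..n}" "t i = 2 * e" by auto
    then show ?thesis using t_odd[of i] by simp
  qed simp
  then show ?thesis using xs by auto
qed

text \<open>In the powers of a reduced word that starts and ends with the same letter, the adjacent
  end letters merge but never cancel, again because the orders are odd.\<close>
lemma palindrome_torsion:
  assumes "reduced n t xs" "rev xs = xs" "ev xs [^] (m :: nat) = \<one>" "0 < m"
  shows "length xs \<le> 1"
proof (rule ccontr)
  assume len: "\<not> length xs \<le> 1"
  then have "xs \<noteq> []" by auto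
  then obtain ys c where c: "xs = ys @ [c] @ rev ys"
    using reduced_symmetric_middle[of n t xs id] assms(1,2) by auto
  then have "ys \<noteq> []" using len by auto
  then obtain i e zs where ys: "ys = (i, e) # zs" by (metis list.exhaust surj_pair)
  define us where "us = zs @ [c] @ rev zs"
  have xs: "xs = (i, e) # us @ [(i, e)]" using c ys by (simp add: us_def)
  have "us \<noteq> []" by (simp add: us_def)
  then have us: "reduced n t us" "us \<noteq> []" "fst (hd us) \<noteq> i" "fst (last us) \<noteq> i"
    and i: "i \<in> {2..n}" and e: "0 < e" "e < t i"
    using assms(1) unfolding xs by (auto simp: reduced_Cons reduced_append)
  \<comment> \<open>The exponent of the syllable that arises when a_i^e meets a_i^e.\<close>
  define d where "d = (2 * e) mod t i"
  have "\<not> t i dvd 2 * e"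
    using t_odd[OF i] e by (metis coprime_dvd_mult_right_iff coprime_right_2_iff_odd nat_dvd_not_less)
  then have d: "0 < d" "d < t i" using t_gt1[OF i] by (auto simp: d_def dvd_eq_mod_eq_0)
  \<comment> \<open>The induction only has to remember the first syllable: a further factor on the
    left turns the old front (i, e) into (i, d) behind \<open>us\<close> and brings a new (i, e) to
    the front.\<close>
  have "\<exists>L. reduced n t ((i, e) # L) \<and> ev xs [^] Suc k = ev ((i, e) # L)" for k
  proof (induction k)
    case 0
    show ?case using assms(1) ev_closed[OF assms(1)] xs
      by (intro exI[of _ "us @ [(i, e)]"]) simp
  next
    case (Suc k)
    then obtain L where L: "reduced n t ((i, e) # L)" "ev xs [^] Suc k = ev ((i, e) # L)" by blast
    have L': "reduced n t L" and dL: "reduced n t ((i, d) # L)" using L(1) d by (auto simp: reduced_Cons)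
    have red: "reduced n t ((i, e) # us @ (i, d) # L)"
      using us dL i e by (auto simp: reduced_Cons reduced_append)
    have ad: "a i [^] d = a i [^] e \<otimes> a i [^] e"
      using a_pow_cong[OF i, of "e + e" d] a_closed[OF i]
      by (simp add: nat_pow_mult d_def cong_def mult_2)
    have "ev xs = a i [^] e \<otimes> (ev us \<otimes> a i [^] e)"
      unfolding xs using us i e a_closed[OF i] by (simp add: ev_append reduced_single)
    then have "ev xs \<otimes> ev ((i, e) # L) = a i [^] e \<otimes> (ev us \<otimes> (a i [^] d \<otimes> ev L))"
      using us i L' a_closed[OF i] by (simp add: ad m_assoc)
    also have "\<dots> = ev ((i, e) # us @ (i, d) # L)"
      using us dL by (simp add: ev_append)
    finally have "ev xs [^] Suc (Suc k) = ev ((i, e) # us @ (i, d) # L)"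
      using L(2) assms(1) nat_pow_Suc2[of "ev xs" "Suc k"] by simp
    then show ?case using red by blast
  qed
  from this[of "m - 1"] obtain L where "reduced n t ((i, e) # L)" "ev ((i, e) # L) = ev []"
    using assms(3,4) by auto
  then show False using ev_inj reduced_Nil by blast
qed

text \<open>The condition \<open>inv\<close> says that w_1 inverts u, which makes the normal form of
  u a palindrome if u is in K. It also holds for u = w_1, which the odd exponent excludes.\<close>

lemma inverted_torsion_is_a_power:
  assumes u: "u \<in> carrier W" "u \<noteq> \<one>" and m: "u [^] (m :: nat) = \<one>" "odd m"
    and inv: "w 1 \<otimes> u \<otimes> (w 1 \<otimes> u) = \<one>"
  shows "\<exists>i\<in>{2..n}. \<exists>e. 0 < e \<and> e < t i \<and> u = a i [^] e"
proof -
  obtain xs b where xs: "reduced n t xs" "u = ev xs \<otimes> (if b then w 1 else \<one>)"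
    using nf_exists u by blast
  \<comment> \<open>If u = x w_1, then w_1 u = w_1 x w_1 is in K and squares to 1; K has no
    involutions, so x is trivial and u = w_1.\<close>
  have "\<not> b"
  proof
    assume b
    then have "w 1 \<otimes> u = ev (neg t xs)" using xs conj_ev by (simp add: m_assoc)
    then have "neg t xs = []" using inv xs ev_involution[of "neg t xs"] reduced_neg by simp
    then have "xs = []" by (simp add: neg_def)
    then have "u = w 1" using \<open>b\<close> xs by simp
    obtain k where "m = Suc (2 * k)" using \<open>odd m\<close> by (metis oddE Suc_eq_plus1)
    have "w 1 [^] (2 * k) = (w 1 [^] (2::nat)) [^] k" by (simp add: nat_pow_pow)
    also have "w 1 [^] (2::nat) = \<one>" using w1_sq by (simp add: numeral_2_eq_2)
    finally have "w 1 [^] m = w 1" using \<open>m = _\<close> by simp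
    then show False using m \<open>u = w 1\<close> w1_neq_one by simp
  qed
  then have ux: "u = ev xs" using xs by simp
  have "ev (neg t xs) \<otimes> ev xs = w 1 \<otimes> u \<otimes> (w 1 \<otimes> u)"
    unfolding conj_ev[OF xs(1), symmetric] using xs(1) by (simp add: ux m_assoc)
  then have "rev (neg t xs) = neg t xs"
    using palindrome_if_conj_inverse[of "neg t xs"] inv neg_neg reduced_neg xs(1) by simp
  then have pal: "rev xs = xs" using neg_neg[OF xs(1)] by (metis neg_simps(4))
  have "length xs \<le> 1"
    using palindrome_torsion[OF xs(1) pal, of m] m ux by (auto intro: Nat.gr0I)
  moreover have "xs \<noteq> []" using ux u by auto
  ultimately obtain i e where "xs = [(i, e)]"
    by (metis One_nat_def Suc_le_mono bot_nat_0.extremum_uniqueI length_0_conv length_Cons list.exhaust surj_pair)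
  then show ?thesis using ux xs(1) a_closed by (auto simp: reduced_Cons)
qed

end

section \<open>Automorphisms\<close>

lemma coprime_nat_iff: "coprime a m \<longleftrightarrow> (\<exists>x. [a * x = 1] (mod m))" for a m :: nat
  by (simp add: coprime_iff_invertible_nat One_nat_def)

section \<open>The automorphism group of an arbitrary group\<close>

context group
begin

abbreviation "Aut \<equiv> AutoGroup G"

lemma carrier_Aut [simp]: "carrier Aut = auto G"
  by (simp add: AutoGroup_def)

lemma auto_closed [intro, simp]: "\<phi> \<in> auto G \<Longrightarrow> x \<in> carrier G \<Longrightarrow> \<phi> x \<in> carrier G"
  by (auto simp: auto_def hom_def)

lemma auto_hom: "\<phi> \<in> auto G \<Longrightarrow> \<phi> \<in> hom G G"
  by (simp add: auto_def)

lemma auto_inj: "\<phi> \<in> auto G \<Longrightarrow> x \<in> carrier G \<Longrightarrow> y \<in> carrier G \<Longrightarrow> \<phi> x = \<phi> y \<longleftrightarrow> x = y"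
  by (auto simp: auto_def Bij_def bij_betw_def inj_on_eq_iff)

lemma auto_mult: "\<phi> \<in> auto G \<Longrightarrow> x \<in> carrier G \<Longrightarrow> y \<in> carrier G \<Longrightarrow> \<phi> (x \<otimes> y) = \<phi> x \<otimes> \<phi> y"
  by (rule hom_mult[OF auto_hom])

lemma auto_one: "\<phi> \<in> auto G \<Longrightarrow> \<phi> \<one> = \<one>"
  by (rule hom_one[OF auto_hom is_group is_group])

lemma auto_pow: "\<phi> \<in> auto G \<Longrightarrow> x \<in> carrier G \<Longrightarrow> \<phi> (x [^] (e :: nat)) = \<phi> x [^] e"
  by (simp add: hom_nat_pow auto_hom is_group)

lemma auto_inv: "\<phi> \<in> auto G \<Longrightarrow> x \<in> carrier G \<Longrightarrow> \<phi> (inv x) = inv (\<phi> x)"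
  using auto_mult[of \<phi> "inv x" x] auto_one[of \<phi>] by (metis auto_closed inv_closed inv_equality l_inv)

lemma auto_eqI:
  "\<phi> \<in> auto G \<Longrightarrow> \<psi> \<in> auto G \<Longrightarrow> (\<And>x. x \<in> carrier G \<Longrightarrow> \<phi> x = \<psi> x) \<Longrightarrow> \<phi> = \<psi>"
  by (auto simp: auto_def Bij_def intro: extensionalityI)

lemma Aut_mult_closed [simp]: "\<phi> \<in> auto G \<Longrightarrow> \<psi> \<in> auto G \<Longrightarrow> \<phi> \<otimes>\<^bsub>Aut\<^esub> \<psi> \<in> auto G"
  using group.is_monoid[OF AutoGroup] monoid.m_closed by fastforce

lemma Aut_inv_closed [simp]: "\<phi> \<in> auto G \<Longrightarrow> inv\<^bsub>Aut\<^esub> \<phi> \<in> auto G"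
  using group.inv_closed[OF AutoGroup] by fastforce

lemma Aut_mult_apply:
  "\<phi> \<in> auto G \<Longrightarrow> \<psi> \<in> auto G \<Longrightarrow> x \<in> carrier G \<Longrightarrow> (\<phi> \<otimes>\<^bsub>Aut\<^esub> \<psi>) x = \<phi> (\<psi> x)"
  by (auto simp: AutoGroup_def BijGroup_def auto_def compose_def)

lemma Aut_one_apply: "x \<in> carrier G \<Longrightarrow> \<one>\<^bsub>Aut\<^esub> x = x"
  by (simp add: AutoGroup_def BijGroup_def)

lemma Aut_one_closed [simp]: "\<one>\<^bsub>Aut\<^esub> \<in> auto G"
  using group.is_monoid[OF AutoGroup] monoid.one_closed by fastforce

lemma Aut_inv_apply:
  assumes "\<phi> \<in> auto G" "x \<in> carrier G"
  shows "(inv\<^bsub>Aut\<^esub> \<phi>) (\<phi> x) = x" "\<phi> ((inv\<^bsub>Aut\<^esub> \<phi>) x) = x"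
  using assms group.l_inv[OF AutoGroup, of \<phi>] group.r_inv[OF AutoGroup, of \<phi>]
  by (auto simp: Aut_one_apply simp flip: Aut_mult_apply)

lemma innaut_apply: "x \<in> carrier G \<Longrightarrow> innaut G g x = g \<otimes> x \<otimes> inv g"
  by (simp add: innaut_def)

lemma innaut_inverse:
  assumes "g \<in> carrier G" "x \<in> carrier G"
  shows "innaut G (inv g) (innaut G g x) = x"
proof -
  have "inv g \<otimes> (g \<otimes> x \<otimes> inv g) \<otimes> g = (inv g \<otimes> g) \<otimes> x \<otimes> (inv g \<otimes> g)"
    using assms by (simp only: m_assoc m_closed inv_closed)
  then show ?thesis using assms by (simp add: innaut_apply)
qed

lemma innaut_auto [simp, intro]:
  assumes "g \<in> carrier G"
  shows "innaut G g \<in> auto G"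
proof -
  have "innaut G g \<in> hom G G"
  proof (rule homI)
    fix x y assume xy: "x \<in> carrier G" "y \<in> carrier G"
    have "g \<otimes> (x \<otimes> y) \<otimes> inv g = g \<otimes> x \<otimes> (inv g \<otimes> g) \<otimes> y \<otimes> inv g"
      using assms xy by (simp add: m_assoc)
    also have "\<dots> = (g \<otimes> x \<otimes> inv g) \<otimes> (g \<otimes> y \<otimes> inv g)"
      using assms xy by (simp only: m_assoc m_closed inv_closed)
    finally show "innaut G g (x \<otimes> y) = innaut G g x \<otimes> innaut G g y"
      using xy by (simp add: innaut_apply)
  qed (use assms in \<open>simp add: innaut_apply\<close>)
  moreover have "bij_betw (innaut G g) (carrier G) (carrier G)"
    using assms innaut_inverse[of g] innaut_inverse[of "inv g"]
    by (intro bij_betwI[where g = "innaut G (inv g)"]) (auto simp: innaut_apply)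
  ultimately show ?thesis by (simp add: auto_def Bij_def innaut_def)
qed

lemma innaut_mult:
  assumes "g \<in> carrier G" "h \<in> carrier G"
  shows "innaut G (g \<otimes> h) = innaut G g \<otimes>\<^bsub>Aut\<^esub> innaut G h"
  using assms
  by (intro auto_eqI) (auto simp: Aut_mult_apply innaut_apply m_assoc inv_mult_group)

lemma conj_innaut:
  assumes "\<phi> \<in> auto G" "g \<in> carrier G"
  shows "\<phi> \<otimes>\<^bsub>Aut\<^esub> innaut G g \<otimes>\<^bsub>Aut\<^esub> inv\<^bsub>Aut\<^esub> \<phi> = innaut G (\<phi> g)"
  using assms
  by (intro auto_eqI) (auto simp: Aut_mult_apply innaut_apply auto_mult auto_inv Aut_inv_apply)

lemma Inn_normal: "Inn G \<lhd> Aut"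
proof -
  interpret A: group Aut by (rule AutoGroup)
  interpret group_hom G Aut "innaut G"
    by unfold_locales (auto intro!: homI simp: innaut_mult)
  have "subgroup (Inn G) Aut" unfolding Inn_def by (rule img_is_subgroup)
  then show ?thesis
    unfolding A.normal_inv_iff by (auto simp: Inn_def conj_innaut)
qed

end

section \<open>Automorphisms that fix w_1\<close>

context star_group
begin

sublocale A: group Aut
  by (rule AutoGroup)

lemma w_from_a: "i \<in> {2..n} \<Longrightarrow> w i = w 1 \<otimes> a i"
  by (simp add: w1_cancel)

lemma hom_eqI:
  assumes "f \<in> hom W W" "h \<in> hom W W" "f (w 1) = h (w 1)"
    "\<And>i. i \<in> {2..n} \<Longrightarrow> f (a i) = h (a i)" "x \<in> carrier W"
  shows "f x = h x"
  using assms(5)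
proof (induction rule: gen_induct)
  case one
  then show ?case using assms hom_one is_group by metis
next
  case (mult j g)
  have "f (w j) = h (w j)"
  proof (cases "j = 1")
    case False
    then have "j \<in> {2..n}" using mult by auto
    then show ?thesis
      using assms(3) assms(4)[of j] hom_mult[OF assms(1), of "w 1" "a j"] hom_mult[OF assms(2), of "w 1" "a j"]
        w_from_a[of j] a_closed[of j] by simp
  qed (use assms in simp)
  then show ?case
    using mult hom_mult[OF assms(1), of "w j" g] hom_mult[OF assms(2), of "w j" g] by simp
qed

definition stab :: "('a \<Rightarrow> 'a) set" where
  "stab = {\<phi> \<in> auto W. \<phi> (w 1) = w 1}"

text \<open>The intrinsic form of C; \<open>generate_theta\<close> proves that the automorphisms
  theta_i^k generate it.\<close>

definition Cset :: "('a \<Rightarrow> 'a) set" where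
  "Cset = {\<phi> \<in> stab. \<forall>i\<in>{2..n}. \<exists>e::nat. \<phi> (a i) = a i [^] e}"

text \<open>The intrinsic form of G. That the indices are permuted follows from
  \<open>stab_image\<close>, and that blocks are preserved from the equality of orders
  there.\<close>

definition Gset :: "('a \<Rightarrow> 'a) set" where
  "Gset = {\<phi> \<in> stab. \<forall>i\<in>{2..n}. \<exists>j\<in>{2..n}. \<phi> (w i) = w j}"

lemma stab_auto: "\<phi> \<in> stab \<Longrightarrow> \<phi> \<in> auto W"
  by (simp add: stab_def)

lemma stab_mult: "\<phi> \<in> stab \<Longrightarrow> \<psi> \<in> stab \<Longrightarrow> \<phi> \<otimes>\<^bsub>Aut\<^esub> \<psi> \<in> stab"
  by (simp add: stab_def Aut_mult_apply)

lemma stab_inv: "\<phi> \<in> stab \<Longrightarrow> inv\<^bsub>Aut\<^esub> \<phi> \<in> stab"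
  using Aut_inv_apply(1)[of \<phi> "w 1"] by (auto simp: stab_def)

lemma stab_one: "\<one>\<^bsub>Aut\<^esub> \<in> stab"
  by (simp add: stab_def Aut_one_apply)

lemma stab_eqI:
  assumes "\<phi> \<in> stab" "\<psi> \<in> stab" "\<And>i. i \<in> {2..n} \<Longrightarrow> \<phi> (a i) = \<psi> (a i)"
  shows "\<phi> = \<psi>"
proof (rule auto_eqI)
  show "\<phi> x = \<psi> x" if "x \<in> carrier W" for x
    by (rule hom_eqI) (use assms that in \<open>auto simp: stab_def auto_hom\<close>)
qed (use assms stab_auto in auto)

lemma stab_a: "\<phi> \<in> stab \<Longrightarrow> i \<in> {2..n} \<Longrightarrow> \<phi> (a i) = w 1 \<otimes> \<phi> (w i)"
  by (simp add: stab_def auto_mult)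

lemma stab_w: "\<phi> \<in> stab \<Longrightarrow> i \<in> {2..n} \<Longrightarrow> \<phi> (w i) = w 1 \<otimes> \<phi> (a i)"
  by (simp add: stab_a w1_cancel stab_auto)

lemma a_neq_one: "i \<in> {2..n} \<Longrightarrow> a i \<noteq> \<one>"
  using a_pow_eq_one_iff[of i 1] t_gt1[of i] a_closed[of i] by auto

text \<open>The image of a_i has odd torsion, and w_1 inverts it because \<phi>(w_i) = w_1
  \<phi>(a_i) is an involution.\<close>

lemma stab_a_power:
  assumes "\<phi> \<in> stab" "i \<in> {2..n}"
  shows "\<exists>j\<in>{2..n}. \<exists>e. 0 < e \<and> e < t j \<and> \<phi> (a i) = a j [^] e"
proof (rule inverted_torsion_is_a_power)
  have \<phi>: "\<phi> \<in> auto W" by (rule stab_auto) fact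
  show "\<phi> (a i) \<in> carrier W" using \<phi> assms a_closed by blast
  show "\<phi> (a i) \<noteq> \<one>"
    using auto_inj[OF \<phi>, of "a i" \<one>] auto_one[OF \<phi>] a_neq_one a_closed assms by auto
  show "\<phi> (a i) [^] t i = \<one>"
    using auto_pow[OF \<phi> a_closed, of i "t i"] assms w_rel[of i] auto_one[OF \<phi>] by simp
  show "odd (t i)" using t_odd assms by blast
  show "w 1 \<otimes> \<phi> (a i) \<otimes> (w 1 \<otimes> \<phi> (a i)) = \<one>"
    using assms \<phi> w_sq[of i] auto_one[OF \<phi>]
    by (simp flip: stab_w[OF assms] auto_mult[OF \<phi>])
qed

text \<open>Following a_i through \<phi> and back gives a_i = a_k^(fe), so k = i. Following a_j
  through the inverse and back gives a_j = a_j^(ef), so e is a unit modulo t_j; then a_j^(e t_i) = 1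
  yields the divisibility.\<close>

lemma stab_a_power_coprime:
  assumes "\<phi> \<in> stab" "i \<in> {2..n}"
  shows "\<exists>j\<in>{2..n}. \<exists>e f. t j dvd t i \<and> coprime e (t j) \<and> 0 < e \<and> e < t j \<and>
    \<phi> (a i) = a j [^] e \<and> (inv\<^bsub>Aut\<^esub> \<phi>) (a j) = a i [^] (f::nat)"
proof -
  let ?\<psi> = "inv\<^bsub>Aut\<^esub> \<phi>"
  have \<phi>: "\<phi> \<in> auto W" by (rule stab_auto) fact
  have \<psi>: "?\<psi> \<in> auto W" using \<phi> by simp
  obtain j e where j: "j \<in> {2..n}" "0 < e" "e < t j" "\<phi> (a i) = a j [^] e"
    using stab_a_power[OF assms] by blast
  obtain k f where k: "k \<in> {2..n}" "?\<psi> (a j) = a k [^] (f::nat)"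
    using stab_a_power[OF stab_inv[OF assms(1)] j(1)] by blast
  have "a i [^] (1::nat) = ?\<psi> (\<phi> (a i))" using Aut_inv_apply[OF \<phi>] a_closed assms(2) by simp
  also have "\<dots> = a k [^] (f * e)"
    using j k a_closed by (simp add: auto_pow[OF \<psi>] nat_pow_pow)
  finally have "k = i"
    using a_pow_eq_iff[OF assms(2) k(1)] t_gt1[OF assms(2)] by auto
  then have f: "?\<psi> (a j) = a i [^] f" using k by simp
  have "a j [^] (1::nat) = \<phi> (?\<psi> (a j))" using Aut_inv_apply[OF \<phi>] a_closed j(1) by simp
  also have "\<dots> = a j [^] (e * f)"
    using j f a_closed assms(2) by (simp add: auto_pow[OF \<phi>] nat_pow_pow)
  finally have "[e * f = 1] (mod t j)"
    using a_pow_eq_iff[OF j(1) j(1)] t_gt1[OF j(1)] by (auto simp: cong_sym_eq)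
  then have cop: "coprime e (t j)" using coprime_nat_iff by blast
  have "a j [^] (e * t i) = \<phi> (a i [^] t i)"
    using j a_closed assms(2) by (simp add: auto_pow[OF \<phi>] nat_pow_pow)
  then have "t j dvd e * t i"
    using w_rel[OF assms(2)] auto_one[OF \<phi>] a_pow_eq_one_iff[OF j(1)] by simp
  then have "t j dvd t i" using cop by (simp add: coprime_commute coprime_dvd_mult_right_iff)
  then show ?thesis using j cop f by blast
qed

text \<open>The divisibility of the orders becomes an equality when the preceding lemma is also
  applied to the inverse automorphism.\<close>

lemma stab_image:
  assumes "\<phi> \<in> stab"
  obtains \<alpha> e where "bij_betw \<alpha> {2..n} {2..n}"
    "\<And>i. i \<in> {2..n} \<Longrightarrow> t (\<alpha> i) = t i \<and> coprime (e i) (t i) \<and> 0 < e i \<and> e i < t i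
       \<and> \<phi> (a i) = a (\<alpha> i) [^] (e i :: nat)"
proof -
  let ?\<psi> = "inv\<^bsub>Aut\<^esub> \<phi>"
  have \<phi>: "\<phi> \<in> auto W" by (rule stab_auto) fact
  \<comment> \<open>The last conjunct serves injectivity: through it the inverse automorphism
    recovers i from its image index.\<close>
  have "\<exists>j e. j \<in> {2..n} \<and> t j = t i \<and> coprime e (t i) \<and> 0 < e \<and> e < t i \<and> \<phi> (a i) = a j [^] (e::nat) \<and>
     (\<exists>f::nat. ?\<psi> (a j) = a i [^] f)"
    if i: "i \<in> {2..n}" for i
  proof -
    obtain j e f where j: "j \<in> {2..n}" "t j dvd t i" "coprime e (t j)" "0 < e" "e < t j" "\<phi> (a i) = a j [^] e"
      "?\<psi> (a j) = a i [^] (f::nat)"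
      using stab_a_power_coprime[OF assms i] by blast
    obtain k e' where k: "k \<in> {2..n}" "t k dvd t j" "?\<psi> (a j) = a k [^] (e'::nat)" "0 < e'" "e' < t k"
      using stab_a_power_coprime[OF stab_inv[OF assms] j(1)] by blast
    have "\<not> t k dvd e'" using k by (auto dest: dvd_imp_le)
    then have "k = i" using a_pow_eq_iff[OF k(1) i, of e' f] k(3) j(7) by auto
    then have "t j = t i" using j k by (auto intro: dvd_antisym)
    then show ?thesis using j by auto
  qed
  then obtain \<alpha> e where *: "\<And>i. i \<in> {2..n} \<Longrightarrow> \<alpha> i \<in> {2..n} \<and> t (\<alpha> i) = t i \<and> coprime (e i) (t i) \<and> 0 < e i \<and> e i < t i
     \<and> \<phi> (a i) = a (\<alpha> i) [^] (e i :: nat) \<and> (\<exists>f::nat. ?\<psi> (a (\<alpha> i)) = a i [^] f)"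
    by metis
  have "inj_on \<alpha> {2..n}"
  proof (rule inj_onI)
    fix i i' assume i: "i \<in> {2..n}" "i' \<in> {2..n}" "\<alpha> i = \<alpha> i'"
    obtain f f' :: nat where f: "?\<psi> (a (\<alpha> i)) = a i [^] f" "?\<psi> (a (\<alpha> i)) = a i' [^] f'"
      using * i by metis
    have "?\<psi> (a (\<alpha> i)) \<noteq> \<one>"
      using auto_inj[of ?\<psi> "a (\<alpha> i)" \<one>] auto_one[of ?\<psi>] \<phi> a_closed[of "\<alpha> i"] a_neq_one[of "\<alpha> i"] * i
      by auto
    then show "i = i'" using a_pow_eq_iff[OF i(1,2), of f f'] a_pow_eq_one_iff[OF i(1)] f by auto
  qed
  moreover have "\<alpha> ` {2..n} \<subseteq> {2..n}" using * by blast
  ultimately have "bij_betw \<alpha> {2..n} {2..n}"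
    by (simp add: bij_betw_def endo_inj_surj)
  then show ?thesis using that * by blast
qed

lemma w1_a_pow_sq:
  assumes "i \<in> {2..n}"
  shows "w 1 \<otimes> a i [^] (e::nat) \<otimes> (w 1 \<otimes> a i [^] e) = \<one>"
proof -
  have "e mod t i \<le> t i" using t_gt1[OF assms] by (simp add: less_imp_le)
  moreover have e: "a i [^] e = a i [^] (e mod t i)" using assms by (intro a_pow_cong) (auto simp: cong_def)
  ultimately have "w 1 \<otimes> a i [^] e \<otimes> w 1 = inv (a i [^] e)"
    using conj_a_pow[OF assms] inv_a_pow[OF assms] by simp
  then show ?thesis using a_closed[OF assms] by (simp flip: m_assoc)
qed

lemma hom_exists:
  assumes "\<And>i. i \<in> {2..n} \<Longrightarrow> \<alpha> i \<in> {2..n} \<and> t (\<alpha> i) = t i"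
  shows "\<exists>h \<in> hom W W. h (w 1) = w 1 \<and> (\<forall>i\<in>{2..n}. h (a i) = a (\<alpha> i) [^] (e i :: nat))"
proof -
  define v where "v j = (if j = 1 then w 1 else w 1 \<otimes> a (\<alpha> j) [^] e j)" for j
  have v: "w 1 \<otimes> v i = a (\<alpha> i) [^] e i" if "i \<in> {2..n}" for i
    using that assms[OF that] a_closed[of "\<alpha> i"] by (auto simp: v_def w1_cancel)
  have "\<exists>h \<in> hom W W. \<forall>j\<in>{1..n}. h (w j) = v j"
  proof (rule universal)
    fix j assume "j \<in> {1..n}"
    then have "j = 1 \<or> j \<in> {2..n}" by auto
    then show "v j \<in> carrier W \<and> v j \<otimes> v j = \<one>"
      using assms[of j] w1_sq w1_a_pow_sq[of "\<alpha> j" "e j"] a_closed[of "\<alpha> j"] by (auto simp: v_def)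
  next
    fix i assume i: "i \<in> {2..n}"
    have "(w 1 \<otimes> v i) [^] t i = (a (\<alpha> i) [^] t (\<alpha> i)) [^] e i"
      using v[OF i] assms[OF i] a_closed[of "\<alpha> i"] by (simp add: nat_pow_pow mult.commute)
    then have "(w 1 \<otimes> v i) [^] t i = \<one>" using assms[OF i] w_rel[of "\<alpha> i"] by simp
    then show "(v 1 \<otimes> v i) [^] t i = \<one>" by (simp add: v_def)
  qed
  then obtain h where h: "h \<in> hom W W" "\<And>j. j \<in> {1..n} \<Longrightarrow> h (w j) = v j" by blast
  have h1: "h (w 1) = w 1" using h(2)[of 1] n_pos by (simp add: v_def)
  moreover have "h (a i) = a (\<alpha> i) [^] e i" if "i \<in> {2..n}" for i
    using hom_mult[OF h(1), of "w 1" "w i"] h(2)[of i] v[OF that] that h1 by simp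
  ultimately show ?thesis using h(1) by blast
qed

text \<open>The inverse comes from \<open>hom_exists\<close> too, with the inverse permutation and
  the inverse exponents modulo t_i.\<close>

lemma stab_exists:
  assumes bij: "bij_betw \<alpha> {2..n} {2..n}"
    and e: "\<And>i. i \<in> {2..n} \<Longrightarrow> t (\<alpha> i) = t i \<and> coprime (e i) (t i)"
  shows "\<exists>\<phi> \<in> stab. \<forall>i\<in>{2..n}. \<phi> (a i) = a (\<alpha> i) [^] (e i :: nat)"
proof -
  define \<beta> where "\<beta> = inv_into {2..n} \<alpha>"
  have \<alpha>: "\<alpha> i \<in> {2..n}" if "i \<in> {2..n}" for i using bij that by (auto simp: bij_betw_def)
  have \<beta>: "\<beta> i \<in> {2..n}" "\<alpha> (\<beta> i) = i" "\<beta> (\<alpha> i) = i" if "i \<in> {2..n}" for i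
    using bij that unfolding \<beta>_def
    by (auto simp: bij_betw_def f_inv_into_f inv_into_into simp del: atLeastAtMost_iff)
  have "\<exists>f. [e i * f = 1] (mod t i)" if "i \<in> {2..n}" for i
    using e[OF that] coprime_nat_iff by blast
  then obtain f where f: "\<And>i. i \<in> {2..n} \<Longrightarrow> [e i * f i = 1] (mod t i)" by metis
  obtain h where h: "h \<in> hom W W" "h (w 1) = w 1" "\<And>i. i \<in> {2..n} \<Longrightarrow> h (a i) = a (\<alpha> i) [^] e i"
    using hom_exists[of \<alpha> e] \<alpha> e by blast
  \<comment> \<open>Since a_i arises from index \<open>\<beta> i\<close> with exponent
    \<open>e (\<beta> i)\<close>, the exponent that undoes it is
    \<open>f (\<beta> i)\<close>.\<close>
  obtain k where k: "k \<in> hom W W" "k (w 1) = w 1" "\<And>i. i \<in> {2..n} \<Longrightarrow> k (a i) = a (\<beta> i) [^] f (\<beta> i)"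
    using hom_exists[of \<beta> "\<lambda>i. f (\<beta> i)"] \<beta> e by metis
  have kh: "k (h x) = x" if "x \<in> carrier W" for x
  proof -
    have "(k \<circ> h) x = id x"
    proof (rule hom_eqI[of "k \<circ> h" id])
      show "k \<circ> h \<in> hom W W" using h k by (auto simp: hom_def Pi_iff)
      show "id \<in> hom W W" by (auto simp: hom_def)
      fix i assume i: "i \<in> {2..n}"
      have "k (h (a i)) = a i [^] (f i * e i)"
        using h(3)[OF i] k(3)[OF \<alpha>[OF i]] a_closed[OF \<alpha>[OF i]] a_closed[OF i] \<beta>(3)[OF i]
        by (simp add: hom_pow[OF k(1)] nat_pow_pow)
      also have "\<dots> = a i [^] (1::nat)" using f[OF i] i by (intro a_pow_cong) (auto simp: mult.commute)
      finally show "(k \<circ> h) (a i) = id (a i)" using a_closed[OF i] by simp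
    qed (use that h k in auto)
    then show ?thesis by simp
  qed
  have hk: "h (k x) = x" if "x \<in> carrier W" for x
  proof -
    have "(h \<circ> k) x = id x"
    proof (rule hom_eqI[of "h \<circ> k" id])
      show "h \<circ> k \<in> hom W W" using h k by (auto simp: hom_def Pi_iff)
      show "id \<in> hom W W" by (auto simp: hom_def)
      fix i assume i: "i \<in> {2..n}"
      have "h (k (a i)) = a i [^] (e (\<beta> i) * f (\<beta> i))"
        using k(3)[OF i] h(3)[OF \<beta>(1)[OF i]] a_closed[OF \<beta>(1)[OF i]] a_closed[OF i] \<beta>(2)[OF i]
        by (simp add: hom_pow[OF h(1)] nat_pow_pow)
      also have "\<dots> = a i [^] (1::nat)"
        using f[OF \<beta>(1)[OF i]] e[OF \<beta>(1)[OF i]] \<beta>(2)[OF i] i by (intro a_pow_cong) auto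
      finally show "(h \<circ> k) (a i) = id (a i)" using a_closed[OF i] by simp
    qed (use that h k in auto)
    then show ?thesis by simp
  qed
  \<comment> \<open>Elements of \<open>auto\<close> are extensional functions on the
    carrier.\<close>
  define \<phi> where "\<phi> = restrict h (carrier W)"
  have "bij_betw \<phi> (carrier W) (carrier W)"
    using h(1) k(1) kh hk by (intro bij_betwI[where g = k]) (auto simp: \<phi>_def hom_def)
  moreover have "\<phi> \<in> hom W W" using h(1) by (auto simp: \<phi>_def hom_def)
  ultimately have "\<phi> \<in> stab" using h(2) by (auto simp: stab_def auto_def Bij_def \<phi>_def)
  then show ?thesis using h(3) a_closed by (intro bexI[of _ \<phi>]) (auto simp: \<phi>_def)
qed

end

section \<open>The subgroups C and G\<close>

context star_group
begin

lemma stab_pow: "\<phi> \<in> stab \<Longrightarrow> i \<in> {2..n} \<Longrightarrow> \<phi> (a i [^] (e::nat)) = \<phi> (a i) [^] e"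
  using auto_pow[OF stab_auto a_closed] .

lemma CsetI:
  "\<phi> \<in> stab \<Longrightarrow> (\<And>i. i \<in> {2..n} \<Longrightarrow> \<exists>e::nat. \<phi> (a i) = a i [^] e) \<Longrightarrow> \<phi> \<in> Cset"
  by (auto simp: Cset_def)

lemma CsetD: "\<phi> \<in> Cset \<Longrightarrow> i \<in> {2..n} \<Longrightarrow> \<exists>e::nat. \<phi> (a i) = a i [^] e"
  unfolding Cset_def by blast

lemma Cset_stab: "\<phi> \<in> Cset \<Longrightarrow> \<phi> \<in> stab"
  by (simp add: Cset_def)

text \<open>\<open>Cset\<close> asks for some exponent only. Compared with \<open>stab_image\<close>
  it is a unit: a nontrivial power of both a_i and its image generator forces the permutation to fix
  i.\<close>

lemma CsetE:
  assumes "\<phi> \<in> Cset"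
  obtains e where "\<And>i. i \<in> {2..n} \<Longrightarrow> \<phi> (a i) = a i [^] (e i :: nat) \<and> 0 < e i \<and> e i < t i \<and> coprime (e i) (t i)"
proof -
  have \<phi>: "\<phi> \<in> stab" using assms by (simp add: Cset_def)
  obtain \<alpha> e where \<alpha>: "\<And>i. i \<in> {2..n} \<Longrightarrow> t (\<alpha> i) = t i \<and> coprime (e i) (t i) \<and> 0 < e i \<and> e i < t i
       \<and> \<phi> (a i) = a (\<alpha> i) [^] (e i :: nat)" "bij_betw \<alpha> {2..n} {2..n}"
    using stab_image[OF \<phi>] by metis
  have "\<alpha> i = i" if i: "i \<in> {2..n}" for i
  proof -
    obtain f :: nat where f: "\<phi> (a i) = a i [^] f" using CsetD[OF assms i] by blast
    have \<alpha>i: "\<alpha> i \<in> {2..n}" using \<alpha>(2) i by (auto simp: bij_betw_def)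
    have "\<not> t (\<alpha> i) dvd e i" using \<alpha>(1)[OF i] by (auto dest: dvd_imp_le)
    then show ?thesis using a_pow_eq_iff[OF \<alpha>i i, of "e i" f] \<alpha>(1)[OF i] f by auto
  qed
  then show ?thesis using that[of e] \<alpha>(1) by metis
qed

lemma Cset_mult_apply:
  assumes "\<phi> \<in> Cset" "\<psi> \<in> Cset" "i \<in> {2..n}" "\<phi> (a i) = a i [^] (e::nat)" "\<psi> (a i) = a i [^] (f::nat)"
  shows "(\<phi> \<otimes>\<^bsub>Aut\<^esub> \<psi>) (a i) = a i [^] (e * f)"
  using assms a_closed
  by (simp add: Cset_def Aut_mult_apply stab_auto stab_pow nat_pow_pow)

lemma Cset_one: "\<one>\<^bsub>Aut\<^esub> \<in> Cset"
proof (rule CsetI[OF stab_one])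
  fix i assume "i \<in> {2..n}"
  then show "\<exists>e::nat. \<one>\<^bsub>Aut\<^esub> (a i) = a i [^] e"
    using a_closed by (intro exI[of _ 1]) (simp add: Aut_one_apply)
qed

lemma Cset_mult: "\<phi> \<in> Cset \<Longrightarrow> \<psi> \<in> Cset \<Longrightarrow> \<phi> \<otimes>\<^bsub>Aut\<^esub> \<psi> \<in> Cset"
  by (rule CsetI) (use stab_mult Cset_stab Cset_mult_apply CsetD in metis)+

lemma Cset_inv:
  assumes "\<phi> \<in> Cset"
  shows "inv\<^bsub>Aut\<^esub> \<phi> \<in> Cset"
proof (rule CsetI)
  have \<phi>: "\<phi> \<in> stab" "\<phi> \<in> auto W" using assms stab_auto by (auto simp: Cset_def)
  show "inv\<^bsub>Aut\<^esub> \<phi> \<in> stab" using \<phi> stab_inv by blast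
  fix i assume i: "i \<in> {2..n}"
  obtain e :: nat where e: "\<phi> (a i) = a i [^] e" "coprime e (t i)" using CsetE[OF assms] i by metis
  then obtain f where f: "[e * f = 1] (mod t i)" using coprime_nat_iff by blast
  have "\<phi> (a i [^] f) = a i [^] (e * f)"
    using \<phi> i e a_closed by (simp add: stab_pow nat_pow_pow)
  also have "\<dots> = a i" using a_pow_cong[OF i f] a_closed[OF i] by simp
  finally have "(inv\<^bsub>Aut\<^esub> \<phi>) (a i) = a i [^] f"
    using Aut_inv_apply(1)[OF \<phi>(2), of "a i [^] f"] a_closed[OF i] by simp
  then show "\<exists>e::nat. (inv\<^bsub>Aut\<^esub> \<phi>) (a i) = a i [^] e" by blast
qed

lemma subgroup_Cset: "subgroup Cset Aut"
  by (rule A.subgroupI)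
    (use Cset_one Cset_mult Cset_inv Cset_stab stab_auto in auto)



text \<open>On <a_j> the map \<phi> is raising to the f-th power, which commutes with \<sigma>. So
  if the inverse of \<sigma> sends a_i into <a_j>, the conjugate raises a_i to the f-th
  power.\<close>

lemma Cset_conj:
  assumes "\<sigma> \<in> stab" "\<phi> \<in> Cset"
  shows "\<sigma> \<otimes>\<^bsub>Aut\<^esub> \<phi> \<otimes>\<^bsub>Aut\<^esub> inv\<^bsub>Aut\<^esub> \<sigma> \<in> Cset"
proof (rule CsetI)
  have \<phi>: "\<phi> \<in> stab" using assms by (simp add: Cset_def)
  show "\<sigma> \<otimes>\<^bsub>Aut\<^esub> \<phi> \<otimes>\<^bsub>Aut\<^esub> inv\<^bsub>Aut\<^esub> \<sigma> \<in> stab" using assms(1) \<phi> stab_mult stab_inv by blast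
  have auto: "\<sigma> \<in> auto W" "\<phi> \<in> auto W" using assms(1) \<phi> stab_auto by auto
  fix i assume i: "i \<in> {2..n}"
  obtain j e where j: "j \<in> {2..n}" "(inv\<^bsub>Aut\<^esub> \<sigma>) (a i) = a j [^] (e::nat)"
    using stab_a_power[OF stab_inv[OF assms(1)] i] by blast
  obtain f :: nat where f: "\<phi> (a j) = a j [^] f" using CsetD[OF assms(2) j(1)] by blast
  have "(\<sigma> \<otimes>\<^bsub>Aut\<^esub> \<phi> \<otimes>\<^bsub>Aut\<^esub> inv\<^bsub>Aut\<^esub> \<sigma>) (a i) = \<sigma> (\<phi> (a j [^] e))"
    using auto j a_closed[OF i] by (simp add: Aut_mult_apply)
  also have "\<phi> (a j [^] e) = (a j [^] e) [^] f"
    using \<phi> j f a_closed by (simp add: stab_pow nat_pow_pow mult.commute)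
  also have "\<sigma> \<dots> = \<sigma> (a j [^] e) [^] f" using auto j a_closed by (simp add: auto_pow)
  also have "\<sigma> (a j [^] e) = a i" using Aut_inv_apply(2)[OF auto(1), of "a i"] j a_closed[OF i] by simp
  finally show "\<exists>e::nat. (\<sigma> \<otimes>\<^bsub>Aut\<^esub> \<phi> \<otimes>\<^bsub>Aut\<^esub> inv\<^bsub>Aut\<^esub> \<sigma>) (a i) = a i [^] e" by blast
qed

text \<open>The property that describes \<open>theta\<close>, kept as a relation until existence and
  uniqueness are known.\<close>

definition is_theta :: "nat \<Rightarrow> nat \<Rightarrow> ('a \<Rightarrow> 'a) \<Rightarrow> bool" where
  "is_theta i k \<phi> \<longleftrightarrow> \<phi> \<in> auto W \<and>
     (\<forall>j\<in>{1..n}. \<phi> (w j) = (if j = i then w 1 \<otimes> a i [^] k else w j))"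

lemma is_theta_iff:
  assumes "i \<in> {2..n}"
  shows "is_theta i k \<phi> \<longleftrightarrow> \<phi> \<in> stab \<and> (\<forall>j\<in>{2..n}. \<phi> (a j) = (if j = i then a i [^] k else a j))"
proof -
  have split: "{1..n} = insert 1 {2..n}" using n_pos by auto
  have "\<phi> (w j) = w 1 \<otimes> u \<longleftrightarrow> \<phi> (a j) = u" if "\<phi> \<in> stab" "j \<in> {2..n}" "u \<in> carrier W" for j u
    using stab_a[OF that(1,2)] stab_w[OF that(1,2)] w1_cancel[OF that(3)] by metis
  note * = this
  have iff: "\<phi> (w j) = (if j = i then w 1 \<otimes> a i [^] k else w j) \<longleftrightarrow> \<phi> (a j) = (if j = i then a i [^] k else a j)"
    if "\<phi> \<in> stab" "j \<in> {2..n}" for j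
    using *[OF that, of "a i [^] k"] *[OF that, of "a j"] w_from_a[OF that(2)] a_closed[OF that(2)]
      a_closed[OF assms] by auto
  have one: "(if 1 = i then w 1 \<otimes> a i [^] k else w 1) = w 1" using assms by auto
  have "(\<forall>j\<in>{2..n}. \<phi> (w j) = (if j = i then w 1 \<otimes> a i [^] k else w j)) \<longleftrightarrow>
      (\<forall>j\<in>{2..n}. \<phi> (a j) = (if j = i then a i [^] k else a j))" if "\<phi> \<in> stab"
    by (intro ball_cong refl iff that)
  then show ?thesis unfolding is_theta_def split ball_simps one stab_def mem_Collect_eq by argo
qed

lemma is_theta_exists:
  assumes "i \<in> {2..n}" "coprime k (t i)"
  shows "\<exists>\<phi>. is_theta i k \<phi>"
proof -
  have "\<exists>\<phi> \<in> stab. \<forall>j\<in>{2..n}. \<phi> (a j) = a (id j) [^] (if j = i then k else 1)"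
    by (rule stab_exists[of id "\<lambda>j. if j = i then k else 1"]) (use assms in auto)
  then obtain \<phi> where \<phi>: "\<phi> \<in> stab" "\<And>j. j \<in> {2..n} \<Longrightarrow> \<phi> (a j) = a (id j) [^] (if j = i then k else 1)"
    by blast
  have "\<phi> (a j) = (if j = i then a i [^] k else a j)" if "j \<in> {2..n}" for j
    using \<phi>(2)[OF that] a_closed[OF that] by auto
  then show ?thesis using \<phi>(1) assms(1) by (intro exI[of _ \<phi>]) (simp add: is_theta_iff)
qed

lemma is_theta_unique: "i \<in> {2..n} \<Longrightarrow> is_theta i k \<phi> \<Longrightarrow> is_theta i k \<psi> \<Longrightarrow> \<phi> = \<psi>"
  by (rule stab_eqI) (auto simp: is_theta_iff simp del: atLeastAtMost_iff)

lemma generate_theta: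
  "generate Aut {\<phi>. \<exists>i k. i \<in> {2..n} \<and> 1 \<le> k \<and> k < t i \<and> coprime k (t i) \<and> is_theta i k \<phi>} = Cset"
  (is "generate Aut ?T = _")
proof
  have T_sub: "?T \<subseteq> Cset"
  proof
    fix \<phi> assume "\<phi> \<in> ?T"
    then obtain i k where i: "i \<in> {2..n}" "is_theta i k \<phi>" by blast
    show "\<phi> \<in> Cset"
    proof (rule CsetI)
      show "\<phi> \<in> stab" using i is_theta_iff by blast
      fix j assume j: "j \<in> {2..n}"
      have "\<phi> (a j) = a j [^] (if j = i then k else 1)"
        using i is_theta_iff[OF i(1)] a_closed[OF j] j by auto
      then show "\<exists>e::nat. \<phi> (a j) = a j [^] e" by blast
    qed
  qed
  then show "generate Aut ?T \<subseteq> Cset" using A.generate_subgroup_incl subgroup_Cset by blast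
  \<comment> \<open>Induction on a bound m for the indices of the a_i that \<phi> moves: dividing by
    the matching \<open>\<theta>\<close> at the top index lowers the bound. For m = n the condition
    is empty.\<close>
  have gen: "\<phi> \<in> generate Aut ?T"
    if "\<phi> \<in> Cset" "\<And>i. i \<in> {2..n} \<Longrightarrow> m < i \<Longrightarrow> \<phi> (a i) = a i" for m \<phi>
    using that
  proof (induction m arbitrary: \<phi>)
    case 0
    have "\<phi> = \<one>\<^bsub>Aut\<^esub>"
    proof (rule stab_eqI)
      fix i assume "i \<in> {2..n}"
      then show "\<phi> (a i) = \<one>\<^bsub>Aut\<^esub> (a i)"
        using 0(2)[of i] a_closed[of i] by (simp add: Aut_one_apply)
    qed (use 0 stab_one Cset_stab in auto)
    then show ?case by (simp add: generate.one)
  next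
    case (Suc m)
    show ?case
    proof (cases "Suc m \<in> {2..n}")
      case False
      then have "\<phi> (a i) = a i" if "i \<in> {2..n}" "m < i" for i
        using Suc.prems(2)[of i] that by (metis Suc_lessI)
      then show ?thesis using Suc by blast
    next
      case i: True
      let ?i = "Suc m"
      obtain e where e: "\<phi> (a ?i) = a ?i [^] (e::nat)" "0 < e" "e < t ?i" "coprime e (t ?i)"
        using CsetE[OF Suc.prems(1)] i by metis
      obtain \<theta> where \<theta>: "is_theta ?i e \<theta>" using is_theta_exists[OF i e(4)] by blast
      have "1 \<le> e" using e by simp
      then have "\<theta> \<in> ?T" using \<theta> e i by blast
      then have gen: "\<theta> \<in> generate Aut ?T" and \<theta>C: "\<theta> \<in> Cset"
        using T_sub by (auto intro: generate.incl)
      have \<theta>a: "\<theta> \<in> auto W" "\<phi> \<in> auto W" using \<theta>C Suc.prems(1) by (auto simp: Cset_def stab_def)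
      define \<psi> where "\<psi> = inv\<^bsub>Aut\<^esub> \<theta> \<otimes>\<^bsub>Aut\<^esub> \<phi>"
      have "\<psi> (a j) = a j" if j: "j \<in> {2..n}" "m < j" for j
      proof -
        have "\<phi> (a j) = \<theta> (a j)"
          using \<theta> e(1) Suc.prems(2)[OF j(1)] is_theta_iff[OF i] j by (cases "j = Suc m") auto
        then show ?thesis
          using \<theta>a a_closed[OF j(1)] by (simp add: \<psi>_def Aut_mult_apply Aut_inv_apply)
      qed
      moreover have "\<psi> \<in> Cset" using \<theta>C Suc.prems(1) by (simp add: \<psi>_def Cset_mult Cset_inv)
      ultimately have "\<psi> \<in> generate Aut ?T" using Suc.IH by blast
      moreover have "\<phi> = \<theta> \<otimes>\<^bsub>Aut\<^esub> \<psi>"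
        using \<theta>a by (simp add: \<psi>_def A.inv_solve_left A.m_assoc[symmetric])
      ultimately show ?thesis using gen by (simp add: generate.eng)
    qed
  qed
  show "Cset \<subseteq> generate Aut ?T"
  proof
    show "\<phi> \<in> generate Aut ?T" if "\<phi> \<in> Cset" for \<phi> using gen[OF that, of n] by simp
  qed
qed

end

section \<open>The decomposition\<close>

lemma set_mult_memI: "h \<in> H \<Longrightarrow> k \<in> K \<Longrightarrow> h \<otimes>\<^bsub>G\<^esub> k \<in> H <#>\<^bsub>G\<^esub> K"
  by (auto simp: set_mult_def)

context star_group
begin

abbreviation \<iota> :: "'a \<Rightarrow> 'a" where "\<iota> \<equiv> innaut W (w 1)"

lemma a_eq_iff: "i \<in> {2..n} \<Longrightarrow> j \<in> {2..n} \<Longrightarrow> a j = a i [^] (e::nat) \<Longrightarrow> j = i"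
  using a_pow_eq_iff[of j i 1 e] t_gt1[of j] a_closed[of j] by auto

lemma Gset_stab: "\<phi> \<in> Gset \<Longrightarrow> \<phi> \<in> stab"
  by (simp add: Gset_def)

text \<open>The permutation and the equality of orders come from \<open>stab_image\<close>; the
  index provided by \<open>Gset\<close> agrees with it because a_j is a power of a_i only for j =
  i.\<close>

lemma Gset_perm:
  assumes "\<phi> \<in> Gset"
  shows "\<exists>\<alpha>. bij_betw \<alpha> {2..n} {2..n} \<and>
    (\<forall>i\<in>{2..n}. t (\<alpha> i) = t i \<and> \<phi> (w i) = w (\<alpha> i))"
proof -
  have \<phi>: "\<phi> \<in> stab" using assms by (rule Gset_stab)
  obtain \<alpha> e where \<alpha>: "bij_betw \<alpha> {2..n} {2..n}"
    "\<And>i. i \<in> {2..n} \<Longrightarrow> t (\<alpha> i) = t i \<and> \<phi> (a i) = a (\<alpha> i) [^] (e i :: nat)"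
    using stab_image[OF \<phi>] by metis
  have "\<phi> (w i) = w (\<alpha> i)" if i: "i \<in> {2..n}" for i
  proof -
    obtain j where j: "j \<in> {2..n}" "\<phi> (w i) = w j" using assms i unfolding Gset_def by blast
    have "\<alpha> i \<in> {2..n}" using \<alpha>(1) i unfolding bij_betw_def by blast
    moreover have "a j = a (\<alpha> i) [^] e i" using stab_a[OF \<phi> i] j(2) \<alpha>(2)[OF i] by simp
    ultimately show ?thesis using a_eq_iff j by metis
  qed
  then show ?thesis using \<alpha> by blast
qed

lemma subgroup_Gset: "subgroup Gset Aut"
proof (rule A.subgroupI)
  show "Gset \<subseteq> carrier Aut" using Gset_stab stab_auto by auto
  have "\<one>\<^bsub>Aut\<^esub> (w i) = w i" if "i \<in> {2..n}" for i
    using that by (simp add: Aut_one_apply)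
  then have "\<one>\<^bsub>Aut\<^esub> \<in> Gset" using stab_one unfolding Gset_def by blast
  then show "Gset \<noteq> {}" by blast
next
  fix \<phi> assume \<phi>: "\<phi> \<in> Gset"
  from Gset_perm[OF \<phi>] obtain \<alpha> where \<alpha>: "bij_betw \<alpha> {2..n} {2..n}"
    "\<forall>i\<in>{2..n}. t (\<alpha> i) = t i \<and> \<phi> (w i) = w (\<alpha> i)"
    by (elim exE conjE)
  have "\<exists>j\<in>{2..n}. (inv\<^bsub>Aut\<^esub> \<phi>) (w i) = w j" if "i \<in> {2..n}" for i
  proof -
    have "i \<in> \<alpha> ` {2..n}" using \<alpha>(1) that by (simp only: bij_betw_def)
    then obtain j where j: "j \<in> {2..n}" "i = \<alpha> j" by (elim imageE)
    have "(inv\<^bsub>Aut\<^esub> \<phi>) (\<phi> (w j)) = w j"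
      by (rule Aut_inv_apply(1)[OF stab_auto[OF Gset_stab[OF \<phi>]] w_closed2[OF j(1)]])
    moreover have "\<phi> (w j) = w i" using \<alpha>(2)[rule_format, OF j(1)] j(2) by simp
    ultimately show ?thesis using j(1) by auto
  qed
  then show "inv\<^bsub>Aut\<^esub> \<phi> \<in> Gset" using stab_inv[OF Gset_stab[OF \<phi>]] unfolding Gset_def by blast
  fix \<psi> assume \<psi>: "\<psi> \<in> Gset"
  have "\<exists>j\<in>{2..n}. (\<phi> \<otimes>\<^bsub>Aut\<^esub> \<psi>) (w i) = w j" if "i \<in> {2..n}" for i
  proof -
    obtain j where j: "j \<in> {2..n}" "\<psi> (w i) = w j" using \<psi> \<open>i \<in> _\<close> unfolding Gset_def by blast
    obtain k where k: "k \<in> {2..n}" "\<phi> (w j) = w k" using \<phi> j unfolding Gset_def by blast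
    have "(\<phi> \<otimes>\<^bsub>Aut\<^esub> \<psi>) (w i) = w k"
      using \<phi> \<psi> that j k Gset_stab stab_auto by (simp add: Aut_mult_apply)
    then show ?thesis using k by blast
  qed
  then show "\<phi> \<otimes>\<^bsub>Aut\<^esub> \<psi> \<in> Gset"
    using stab_mult Gset_stab \<phi> \<psi> unfolding Gset_def by blast
qed

lemma Cset_Int_Gset: "Cset \<inter> Gset = {\<one>\<^bsub>Aut\<^esub>}"
proof -
  have "\<phi> = \<one>\<^bsub>Aut\<^esub>" if \<phi>: "\<phi> \<in> Cset" "\<phi> \<in> Gset" for \<phi>
  proof (rule stab_eqI)
    show "\<phi> \<in> stab" "\<one>\<^bsub>Aut\<^esub> \<in> stab" using \<phi> Cset_stab stab_one by auto
    fix i assume i: "i \<in> {2..n}"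
    obtain j where j: "j \<in> {2..n}" "\<phi> (w i) = w j" using \<phi>(2) i unfolding Gset_def by blast
    then have "\<phi> (a i) = a j" using stab_a[OF Cset_stab[OF \<phi>(1)] i] by simp
    then have "\<phi> (a i) = a i" using CsetD[OF \<phi>(1) i] a_eq_iff[OF i j(1)] by auto
    then show "\<phi> (a i) = \<one>\<^bsub>Aut\<^esub> (a i)" using a_closed[OF i] by (simp add: Aut_one_apply)
  qed
  then show ?thesis
    using subgroup.one_closed[OF subgroup_Cset] subgroup.one_closed[OF subgroup_Gset] by blast
qed

lemma stab_decomp:
  assumes "\<phi> \<in> stab"
  shows "\<exists>c\<in>Cset. \<exists>g\<in>Gset. \<phi> = c \<otimes>\<^bsub>Aut\<^esub> g"
proof -
  obtain \<alpha> e where \<alpha>: "bij_betw \<alpha> {2..n} {2..n}"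
    "\<And>i. i \<in> {2..n} \<Longrightarrow> t (\<alpha> i) = t i \<and> \<phi> (a i) = a (\<alpha> i) [^] (e i :: nat)"
    using stab_image[OF assms] by metis
  \<comment> \<open>The permutation part of \<phi>, with all exponents equal to 1; the quotient of
    \<phi> by it sends every a_j to a power of itself.\<close>
  have "\<exists>g \<in> stab. \<forall>i\<in>{2..n}. g (a i) = a (\<alpha> i) [^] (1::nat)"
    by (rule stab_exists[of \<alpha> "\<lambda>_. 1"]) (use \<alpha> in auto)
  then obtain g where g: "g \<in> stab" "\<And>i. i \<in> {2..n} \<Longrightarrow> g (a i) = a (\<alpha> i) [^] (1::nat)" by blast
  have \<alpha>_in: "\<alpha> i \<in> {2..n}" if "i \<in> {2..n}" for i using \<alpha>(1) that unfolding bij_betw_def by blast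
  have ga: "g (a i) = a (\<alpha> i)" if "i \<in> {2..n}" for i
    using g(2)[OF that] a_closed[OF \<alpha>_in[OF that]] by simp
  have "g (w i) = w (\<alpha> i)" if "i \<in> {2..n}" for i
    using stab_w[OF g(1) that] ga[OF that] w_from_a[OF \<alpha>_in[OF that]] by simp
  then have gG: "g \<in> Gset" using g(1) \<alpha>_in unfolding Gset_def by blast
  define c where "c = \<phi> \<otimes>\<^bsub>Aut\<^esub> inv\<^bsub>Aut\<^esub> g"
  have auto: "\<phi> \<in> auto W" "g \<in> auto W" using assms g(1) stab_auto by auto
  have "c \<in> Cset"
  proof (rule CsetI)
    show "c \<in> stab" unfolding c_def using assms g(1) stab_mult stab_inv by blast
    fix j assume j: "j \<in> {2..n}"
    obtain i where i: "i \<in> {2..n}" "j = \<alpha> i" using \<alpha>(1) j unfolding bij_betw_def by blast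
    have "(inv\<^bsub>Aut\<^esub> g) (a j) = a i"
      using Aut_inv_apply(1)[OF auto(2) a_closed[OF i(1)]] ga[OF i(1)] i(2) by simp
    then have "c (a j) = a j [^] e i"
      using auto \<alpha>(2)[OF i(1)] i(2) a_closed[OF j] by (simp add: c_def Aut_mult_apply)
    then show "\<exists>e::nat. c (a j) = a j [^] e" by blast
  qed
  moreover have "\<phi> = c \<otimes>\<^bsub>Aut\<^esub> g" using auto by (simp add: c_def A.m_assoc)
  ultimately show ?thesis using gG by blast
qed

lemma innaut_one: "innaut W \<one> = \<one>\<^bsub>Aut\<^esub>"
  by (rule auto_eqI) (auto simp: innaut_apply Aut_one_apply)

lemma iota_sq: "\<iota> \<otimes>\<^bsub>Aut\<^esub> \<iota> = \<one>\<^bsub>Aut\<^esub>"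
  using innaut_mult[of "w 1" "w 1"] w1_sq innaut_one by simp

text \<open>So \<iota> is -1 in every unit group U_{t_i}.\<close>

lemma iota_a: "i \<in> {2..n} \<Longrightarrow> \<iota> (a i) = a i [^] (t i - 1)"
  using conj_a_pow[of i 1] t_gt1[of i] a_closed[of i] by (simp add: innaut_apply inv_w1)

lemma iota_Cset: "\<iota> \<in> Cset"
proof (rule CsetI)
  show "\<iota> \<in> stab" using w1_sq by (simp add: stab_def innaut_apply inv_w1)
qed (use iota_a in blast)

lemma generate_iota: "generate Aut {\<iota>} = {\<one>\<^bsub>Aut\<^esub>, \<iota>}"
proof
  have "inv\<^bsub>Aut\<^esub> \<iota> = \<iota>" using iota_sq by (intro A.inv_equality) auto
  then have "subgroup {\<one>\<^bsub>Aut\<^esub>, \<iota>} Aut"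
    by (intro A.subgroupI) (auto simp: iota_sq)
  then show "generate Aut {\<iota>} \<subseteq> {\<one>\<^bsub>Aut\<^esub>, \<iota>}" by (intro A.generate_subgroup_incl) auto
  show "{\<one>\<^bsub>Aut\<^esub>, \<iota>} \<subseteq> generate Aut {\<iota>}" by (auto intro: generate.intros)
qed

lemma Inn_Int_stab: "Inn W \<inter> stab \<subseteq> {\<one>\<^bsub>Aut\<^esub>, \<iota>}"
proof
  fix \<phi> assume "\<phi> \<in> Inn W \<inter> stab"
  then obtain g where g: "g \<in> carrier W" "\<phi> = innaut W g" "g \<otimes> w 1 \<otimes> inv g = w 1"
    by (auto simp: Inn_def stab_def innaut_apply)
  have "w 1 \<otimes> g \<otimes> w 1 = (g \<otimes> w 1 \<otimes> inv g) \<otimes> g \<otimes> w 1" by (simp only: g(3))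
  also have "\<dots> = g \<otimes> (w 1 \<otimes> (inv g \<otimes> g) \<otimes> w 1)" using g(1) by (simp only: m_assoc m_closed inv_closed w1_closed)
  also have "\<dots> = g" using g(1) w1_sq by simp
  finally show "\<phi> \<in> {\<one>\<^bsub>Aut\<^esub>, \<iota>}" using centralizer_w1[OF g(1)] g(2) innaut_one by auto
qed

lemma auto_decomp:
  assumes "\<phi> \<in> auto W"
  shows "\<exists>g\<in>Inn W. \<exists>s\<in>stab. \<phi> = g \<otimes>\<^bsub>Aut\<^esub> s"
proof -
  have "\<phi> (w 1) \<otimes> \<phi> (w 1) = \<one>"
    using assms w1_sq auto_one[OF assms] by (simp flip: auto_mult)
  moreover have "\<phi> (w 1) \<noteq> \<one>"
    using auto_inj[OF assms, of "w 1" \<one>] auto_one[OF assms] w1_neq_one by auto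
  ultimately obtain z where z: "z \<in> carrier W" "\<phi> (w 1) = z \<otimes> w 1 \<otimes> inv z"
    using involution_conj_w1[of "\<phi> (w 1)"] assms by auto
  define s where "s = inv\<^bsub>Aut\<^esub> (innaut W z) \<otimes>\<^bsub>Aut\<^esub> \<phi>"
  have "\<phi> (w 1) = innaut W z (w 1)" using z by (simp add: innaut_apply)
  then have "s (w 1) = w 1"
    using assms z(1) by (simp add: s_def Aut_mult_apply Aut_inv_apply)
  then have "s \<in> stab" using assms z(1) by (simp add: stab_def s_def)
  moreover have "\<phi> = innaut W z \<otimes>\<^bsub>Aut\<^esub> s"
    using assms z(1) by (simp add: s_def A.m_assoc[symmetric])
  ultimately show ?thesis using z(1) unfolding Inn_def by blast
qed

text \<open>Sign of the exponent at a factor whose order is divisible by a prime \<open>p \<equiv> 3 (mod 4)\<close>: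
  the Legendre symbol is a homomorphism to \<open>{1, -1}\<close> that is nontrivial at \<open>-1\<close>,
  so its kernel is a complement of the inversion.\<close>
lemma complement_exists:
  assumes p: "Factorial_Ring.prime (p::nat)" "p mod 4 = 3" and j: "j \<in> {2..n}" and dvd: "p dvd t j"
  shows "\<exists>D. subgroup D Aut \<and> D \<subseteq> Cset \<and> D \<inter> {\<one>\<^bsub>Aut\<^esub>, \<iota>} = {\<one>\<^bsub>Aut\<^esub>}
    \<and> Cset = D <#>\<^bsub>Aut\<^esub> {\<one>\<^bsub>Aut\<^esub>, \<iota>}"
proof -
  \<comment> \<open>By Euler's criterion e^h modulo p is the Legendre symbol of e. As p mod 4 = 3, h
    is odd and the symbol of -1 is -1.\<close>
  define h where "h = (p - 1) div 2"
  have h: "odd h" "p - 1 = 2 * h" using p(2) unfolding h_def by presburger+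
  have p3: "3 \<le> p" using p(2) by (metis mod_less_eq_dividend)
  define D where "D = {\<phi> \<in> Cset. \<exists>e::nat. \<phi> (a j) = a j [^] e \<and> [int e ^ h = 1] (mod int p)}"
  \<comment> \<open>The exponent at a_j is determined modulo t_j, hence modulo its divisor p; so the
    condition in \<open>D\<close> does not depend on the chosen e.\<close>
  have mod_p: "[int e = int f] (mod int p)" if "a j [^] e = a j [^] f" for e f :: nat
  proof -
    have "[e = f] (mod t j)" using a_pow_eq_iff[OF j j] that by (auto simp: cong_def dvd_eq_mod_eq_0)
    then have "[e = f] (mod p)" using dvd by (rule cong_dvd_modulus_nat)
    then show ?thesis by (simp add: cong_int_iff)
  qed
  have minus: "[int (t j - 1) = - 1] (mod int p)"
    using dvd t_gt1[OF j] by (auto simp: cong_iff_dvd_diff of_nat_diff)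
  have sub: "D \<subseteq> Cset" by (auto simp: D_def)
  have one: "\<one>\<^bsub>Aut\<^esub> \<in> D"
    using Cset_one a_closed[OF j] by (auto simp: D_def Aut_one_apply intro!: exI[of _ 1])
  have "subgroup D Aut"
  proof (rule A.subgroupI)
    show "D \<subseteq> carrier Aut" using sub Cset_stab stab_auto by auto
    show "D \<noteq> {}" using one by blast
    fix \<phi> assume "\<phi> \<in> D"
    then obtain e :: nat where e: "\<phi> \<in> Cset" "\<phi> (a j) = a j [^] e" "[int e ^ h = 1] (mod int p)"
      by (auto simp: D_def)
    obtain f :: nat where f: "(inv\<^bsub>Aut\<^esub> \<phi>) (a j) = a j [^] f" using CsetD[OF Cset_inv[OF e(1)] j] by blast
    have "a j [^] (e * f) = (\<phi> \<otimes>\<^bsub>Aut\<^esub> inv\<^bsub>Aut\<^esub> \<phi>) (a j)"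
      by (rule Cset_mult_apply[symmetric]) (use e f j Cset_inv in auto)
    also have "\<dots> = a j [^] (1::nat)"
      using e(1) Cset_stab stab_auto a_closed[OF j] by (simp add: Aut_one_apply)
    finally have "[int e * int f = 1] (mod int p)" using mod_p by fastforce
    then have "[(int e * int f) ^ h = 1] (mod int p)" using cong_pow by fastforce
    moreover have "[(int e * int f) ^ h = 1 * int f ^ h] (mod int p)"
      unfolding power_mult_distrib by (rule cong_mult[OF e(3) cong_refl])
    ultimately have "[int f ^ h = 1] (mod int p)" by (metis cong_sym cong_trans mult_1)
    then show "inv\<^bsub>Aut\<^esub> \<phi> \<in> D" using f Cset_inv[OF e(1)] by (auto simp: D_def)
    fix \<psi> assume "\<psi> \<in> D"
    then obtain e' :: nat where e': "\<psi> \<in> Cset" "\<psi> (a j) = a j [^] e'" "[int e' ^ h = 1] (mod int p)"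
      by (auto simp: D_def)
    have "(\<phi> \<otimes>\<^bsub>Aut\<^esub> \<psi>) (a j) = a j [^] (e * e')" by (rule Cset_mult_apply) (use e e' j in auto)
    moreover have "[int (e * e') ^ h = 1] (mod int p)"
      using cong_mult[OF e(3) e'(3)] by (simp add: power_mult_distrib)
    ultimately show "\<phi> \<otimes>\<^bsub>Aut\<^esub> \<psi> \<in> D" using Cset_mult[OF e(1) e'(1)] by (auto simp: D_def)
  qed
  moreover have "\<iota> \<notin> D"
  proof
    assume "\<iota> \<in> D"
    then obtain e :: nat where e: "\<iota> (a j) = a j [^] e" "[int e ^ h = 1] (mod int p)"
      by (auto simp: D_def)
    then have "[int e = - 1] (mod int p)" using mod_p[of e "t j - 1"] iota_a[OF j] minus cong_trans by metis
    then have "[int e ^ h = (- 1) ^ h] (mod int p)" by (rule cong_pow)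
    then have "[1 = (- 1) ^ h] (mod int p)" by (rule cong_trans[OF cong_sym[OF e(2)]])
    then have "[1 = - 1] (mod int p)" using h(1) by simp
    then have "int p dvd 2" by (simp add: cong_iff_dvd_diff)
    then show False using p3 by (auto dest: zdvd_imp_le)
  qed
  moreover have "Cset = D <#>\<^bsub>Aut\<^esub> {\<one>\<^bsub>Aut\<^esub>, \<iota>}"
  proof
    show "D <#>\<^bsub>Aut\<^esub> {\<one>\<^bsub>Aut\<^esub>, \<iota>} \<subseteq> Cset"
      using sub Cset_mult Cset_one iota_Cset by (auto simp: set_mult_def)
    show "Cset \<subseteq> D <#>\<^bsub>Aut\<^esub> {\<one>\<^bsub>Aut\<^esub>, \<iota>}"
    proof
      fix \<phi> assume \<phi>: "\<phi> \<in> Cset"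
      then have auto: "\<phi> \<in> auto W" using Cset_stab stab_auto by blast
      obtain e :: nat where e: "\<phi> (a j) = a j [^] e" "coprime e (t j)" using CsetE[OF \<phi>] j by metis
      have "\<not> p dvd e" using e(2) dvd p(1) by (metis coprime_common_divisor not_prime_unit)
      \<comment> \<open>Fermat gives e^(2h) = 1 modulo p, and p divides one of e^h - 1 and e^h +
        1.\<close>
      then have "[e ^ (p - 1) = 1] (mod p)" using fermat_theorem p(1) by blast
      then have "[int (e ^ (p - 1)) = int 1] (mod int p)" by (simp only: cong_int_iff)
      then have "int p dvd int e ^ (2 * h) - 1" unfolding h(2) by (simp add: cong_iff_dvd_diff)
      then have "int p dvd (int e ^ h - 1) * (int e ^ h + 1)"
        by (simp add: power_mult power2_eq_square algebra_simps power_even_eq)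
      then have "int p dvd int e ^ h - 1 \<or> int p dvd int e ^ h + 1"
        using p(1) by (simp add: prime_dvd_mult_iff)
      then consider "[int e ^ h = 1] (mod int p)" | "[int e ^ h = - 1] (mod int p)"
        by (auto simp: cong_iff_dvd_diff)
      then show "\<phi> \<in> D <#>\<^bsub>Aut\<^esub> {\<one>\<^bsub>Aut\<^esub>, \<iota>}"
      proof cases
        case 1
        then have "\<phi> \<in> D" using \<phi> e by (auto simp: D_def)
        moreover have "\<phi> = \<phi> \<otimes>\<^bsub>Aut\<^esub> \<one>\<^bsub>Aut\<^esub>" using auto by simp
        ultimately show ?thesis unfolding set_mult_def by blast
      next
        case 2
        have "(\<phi> \<otimes>\<^bsub>Aut\<^esub> \<iota>) (a j) = a j [^] (e * (t j - 1))"
          by (rule Cset_mult_apply) (use e iota_a iota_Cset \<phi> j in auto)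
        \<comment> \<open>Composing with \<iota> flips the sign, since (-1)^h = -1.\<close>
        moreover have "[int e ^ h * int (t j - 1) ^ h = - 1 * (- 1) ^ h] (mod int p)"
          by (intro cong_mult cong_pow 2 minus)
        then have "[int (e * (t j - 1)) ^ h = 1] (mod int p)"
          using h(1) by (simp add: power_mult_distrib)
        ultimately have "\<phi> \<otimes>\<^bsub>Aut\<^esub> \<iota> \<in> D" using \<phi> Cset_mult iota_Cset by (auto simp: D_def)
        moreover have "\<phi> = (\<phi> \<otimes>\<^bsub>Aut\<^esub> \<iota>) \<otimes>\<^bsub>Aut\<^esub> \<iota>" using auto iota_sq by (simp add: A.m_assoc)
        ultimately show ?thesis unfolding set_mult_def by blast
      qed
    qed
  qed
  ultimately show ?thesis using sub one by (intro exI[of _ D]) auto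
qed

text \<open>Write \<phi> = r s with r inner and s fixing w_1. Conjugation by s preserves C by
  \<open>Cset_conj\<close>, and conjugation by r only adds inner factors: r c' r^-1 = r (c' r^-1
  c'^-1) c'.\<close>

lemma Inn_Cset_normal: "(Inn W <#>\<^bsub>Aut\<^esub> Cset) \<lhd> Aut"
proof (rule A.normal_invI)
  interpret I: normal "Inn W" Aut by (rule Inn_normal)
  show "subgroup (Inn W <#>\<^bsub>Aut\<^esub> Cset) Aut"
    by (rule A.mult_norm_subgroup[OF Inn_normal subgroup_Cset])
  have Inn_auto: "x \<in> auto W" if "x \<in> Inn W" for x using that I.subset by auto
  have C_auto: "x \<in> auto W" if "x \<in> Cset" for x using that Cset_stab stab_auto by blast
  fix \<phi> x assume "\<phi> \<in> carrier Aut" "x \<in> Inn W <#>\<^bsub>Aut\<^esub> Cset"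
  then obtain g c where x: "x = g \<otimes>\<^bsub>Aut\<^esub> c" "g \<in> Inn W" "c \<in> Cset" and "\<phi> \<in> auto W"
    by (auto simp: set_mult_def)
  obtain r s where \<phi>: "\<phi> = r \<otimes>\<^bsub>Aut\<^esub> s" "r \<in> Inn W" "s \<in> stab" using auto_decomp[OF \<open>\<phi> \<in> auto W\<close>] by blast
  define c' where "c' = s \<otimes>\<^bsub>Aut\<^esub> c \<otimes>\<^bsub>Aut\<^esub> inv\<^bsub>Aut\<^esub> s"
  define g' where "g' = \<phi> \<otimes>\<^bsub>Aut\<^esub> g \<otimes>\<^bsub>Aut\<^esub> inv\<^bsub>Aut\<^esub> \<phi>"
  define r' where "r' = c' \<otimes>\<^bsub>Aut\<^esub> inv\<^bsub>Aut\<^esub> r \<otimes>\<^bsub>Aut\<^esub> inv\<^bsub>Aut\<^esub> c'"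
  have c': "c' \<in> Cset" unfolding c'_def using Cset_conj \<phi>(3) x(3) by blast
  have auto: "g \<in> carrier Aut" "c \<in> carrier Aut" "r \<in> carrier Aut" "s \<in> carrier Aut" "c' \<in> carrier Aut"
    using x \<phi> c' Inn_auto C_auto stab_auto by auto
  have g': "g' \<in> Inn W" and r': "r' \<in> Inn W"
    unfolding g'_def r'_def using x \<phi> auto I.inv_op_closed2 \<open>\<phi> \<in> auto W\<close> by auto
  have "g' \<otimes>\<^bsub>Aut\<^esub> r \<otimes>\<^bsub>Aut\<^esub> r' \<otimes>\<^bsub>Aut\<^esub> c' = g' \<otimes>\<^bsub>Aut\<^esub> (r \<otimes>\<^bsub>Aut\<^esub> c' \<otimes>\<^bsub>Aut\<^esub> inv\<^bsub>Aut\<^esub> r)"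
    using auto g' Inn_auto by (simp add: r'_def A.m_assoc del: carrier_Aut)
  also have "r \<otimes>\<^bsub>Aut\<^esub> c' \<otimes>\<^bsub>Aut\<^esub> inv\<^bsub>Aut\<^esub> r = \<phi> \<otimes>\<^bsub>Aut\<^esub> c \<otimes>\<^bsub>Aut\<^esub> inv\<^bsub>Aut\<^esub> \<phi>"
    using auto by (simp add: c'_def \<phi>(1) A.inv_mult_group A.m_assoc)
  also have "g' \<otimes>\<^bsub>Aut\<^esub> \<dots> = \<phi> \<otimes>\<^bsub>Aut\<^esub> x \<otimes>\<^bsub>Aut\<^esub> inv\<^bsub>Aut\<^esub> \<phi>"
  proof -
    have "inv\<^bsub>Aut\<^esub> \<phi> \<otimes>\<^bsub>Aut\<^esub> (\<phi> \<otimes>\<^bsub>Aut\<^esub> y) = y" if "y \<in> carrier Aut" for y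
      using that \<open>\<phi> \<in> auto W\<close> by (simp flip: A.m_assoc)
    then show ?thesis using auto \<open>\<phi> \<in> auto W\<close> by (simp add: g'_def x(1) A.m_assoc)
  qed
  finally show "\<phi> \<otimes>\<^bsub>Aut\<^esub> x \<otimes>\<^bsub>Aut\<^esub> inv\<^bsub>Aut\<^esub> \<phi> \<in> Inn W <#>\<^bsub>Aut\<^esub> Cset"
    using I.m_closed[OF I.m_closed[OF g' \<phi>(2)] r'] c' unfolding set_mult_def by blast
qed

theorem semidirect_decomposition:
  assumes "subgroup D Aut" "D \<subseteq> Cset" "D \<inter> {\<one>\<^bsub>Aut\<^esub>, \<iota>} = {\<one>\<^bsub>Aut\<^esub>}"
    "Cset = D <#>\<^bsub>Aut\<^esub> {\<one>\<^bsub>Aut\<^esub>, \<iota>}"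
  shows "Inn W \<lhd> (Aut\<lparr>carrier := Inn W <#>\<^bsub>Aut\<^esub> Cset\<rparr>)"
    and "Inn W \<inter> D = {\<one>\<^bsub>Aut\<^esub>}"
    and "Inn W <#>\<^bsub>Aut\<^esub> Cset = Inn W <#>\<^bsub>Aut\<^esub> D"
    and "(Inn W <#>\<^bsub>Aut\<^esub> D) \<lhd> Aut"
    and "(Inn W <#>\<^bsub>Aut\<^esub> D) \<inter> Gset = {\<one>\<^bsub>Aut\<^esub>}"
    and "carrier Aut = (Inn W <#>\<^bsub>Aut\<^esub> D) <#>\<^bsub>Aut\<^esub> Gset"
proof -
  interpret I: normal "Inn W" Aut by (rule Inn_normal)
  interpret D: subgroup D Aut by (rule assms(1))
  show "Inn W \<lhd> (Aut\<lparr>carrier := Inn W <#>\<^bsub>Aut\<^esub> Cset\<rparr>)"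
    by (rule A.normal_in_normal_set_mult[OF Inn_normal subgroup_Cset])
  show "Inn W \<inter> D = {\<one>\<^bsub>Aut\<^esub>}"
    using Inn_Int_stab assms(2,3) Cset_stab I.one_closed D.one_closed by blast
  have iota: "\<iota> \<in> Inn W" by (auto simp: Inn_def)
  show eq: "Inn W <#>\<^bsub>Aut\<^esub> Cset = Inn W <#>\<^bsub>Aut\<^esub> D"
  proof
    show "Inn W <#>\<^bsub>Aut\<^esub> D \<subseteq> Inn W <#>\<^bsub>Aut\<^esub> Cset" using assms(2) by (intro mono_set_mult) auto
    show "Inn W <#>\<^bsub>Aut\<^esub> Cset \<subseteq> Inn W <#>\<^bsub>Aut\<^esub> D"
    proof
      fix x assume "x \<in> Inn W <#>\<^bsub>Aut\<^esub> Cset"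
      then obtain g d z where x: "x = g \<otimes>\<^bsub>Aut\<^esub> (d \<otimes>\<^bsub>Aut\<^esub> z)" "g \<in> Inn W" "d \<in> D" "z \<in> {\<one>\<^bsub>Aut\<^esub>, \<iota>}"
        unfolding assms(4) by (auto simp: set_mult_def)
      have z: "z \<in> Inn W" using x iota I.one_closed by blast
      have car: "g \<in> carrier Aut" "d \<in> carrier Aut" "z \<in> carrier Aut"
        using x z I.subset D.subset by auto
      \<comment> \<open>As z is inner, d z = (d z d^-1) d moves it into the normal factor, and only
        d remains on the right.\<close>
      have "x = g \<otimes>\<^bsub>Aut\<^esub> (d \<otimes>\<^bsub>Aut\<^esub> z \<otimes>\<^bsub>Aut\<^esub> inv\<^bsub>Aut\<^esub> d) \<otimes>\<^bsub>Aut\<^esub> d"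
        using x car by (simp add: A.m_assoc)
      moreover have "g \<otimes>\<^bsub>Aut\<^esub> (d \<otimes>\<^bsub>Aut\<^esub> z \<otimes>\<^bsub>Aut\<^esub> inv\<^bsub>Aut\<^esub> d) \<in> Inn W"
        using I.inv_op_closed2[OF car(2) z] x(2) by (rule I.m_closed[rotated])
      ultimately show "x \<in> Inn W <#>\<^bsub>Aut\<^esub> D" using x(3) unfolding set_mult_def by blast
    qed
  qed
  show "(Inn W <#>\<^bsub>Aut\<^esub> D) \<lhd> Aut" using Inn_Cset_normal unfolding eq .
  show "(Inn W <#>\<^bsub>Aut\<^esub> D) \<inter> Gset = {\<one>\<^bsub>Aut\<^esub>}"
  proof -
    have "x = \<one>\<^bsub>Aut\<^esub>" if x: "x \<in> Inn W <#>\<^bsub>Aut\<^esub> Cset" "x \<in> Gset" for x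
    proof -
      obtain g c where gc: "x = g \<otimes>\<^bsub>Aut\<^esub> c" "g \<in> Inn W" "c \<in> Cset" using x by (auto simp: set_mult_def)
      have car: "g \<in> carrier Aut" "c \<in> carrier Aut"
        using gc I.subset Cset_stab stab_auto by auto
      \<comment> \<open>The inner factor g fixes w_1, as x and c do, so it is trivial or \<iota> and
        lies in C; then x is in both C and G.\<close>
      have "g = x \<otimes>\<^bsub>Aut\<^esub> inv\<^bsub>Aut\<^esub> c" using gc car by (simp add: A.m_assoc)
      then have "g \<in> stab" using x(2) gc(3) Gset_stab Cset_stab stab_mult stab_inv by blast
      then have "g \<in> Cset" using gc(2) Inn_Int_stab Cset_one iota_Cset by blast
      then have "x \<in> Cset" using gc Cset_mult by blast
      then show ?thesis using x(2) Cset_Int_Gset by blast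
    qed
    moreover have "\<one>\<^bsub>Aut\<^esub> \<in> Inn W <#>\<^bsub>Aut\<^esub> Cset"
      by (rule subgroup.one_closed[OF A.mult_norm_subgroup[OF Inn_normal subgroup_Cset]])
    ultimately show ?thesis
      using subgroup.one_closed[OF subgroup_Gset] unfolding eq[symmetric] by blast
  qed
  show "carrier Aut = (Inn W <#>\<^bsub>Aut\<^esub> D) <#>\<^bsub>Aut\<^esub> Gset"
  proof
    have "Inn W <#>\<^bsub>Aut\<^esub> Cset \<subseteq> carrier Aut" "Gset \<subseteq> carrier Aut"
      using A.mult_norm_subgroup[OF Inn_normal subgroup_Cset] subgroup_Gset subgroup.subset by blast+
    then show "(Inn W <#>\<^bsub>Aut\<^esub> D) <#>\<^bsub>Aut\<^esub> Gset \<subseteq> carrier Aut"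
      unfolding eq[symmetric] by (rule A.setmult_subset_G)
    show "carrier Aut \<subseteq> (Inn W <#>\<^bsub>Aut\<^esub> D) <#>\<^bsub>Aut\<^esub> Gset"
    proof
      fix \<phi> assume "\<phi> \<in> carrier Aut"
      then obtain r s where \<phi>: "\<phi> = r \<otimes>\<^bsub>Aut\<^esub> s" "r \<in> Inn W" "s \<in> stab"
        using auto_decomp[of \<phi>] by auto
      obtain c g where s: "s = c \<otimes>\<^bsub>Aut\<^esub> g" "c \<in> Cset" "g \<in> Gset" using stab_decomp[OF \<phi>(3)] by blast
      have "r \<in> carrier Aut" "c \<in> carrier Aut" "g \<in> carrier Aut"
        using \<phi> s I.subset Cset_stab Gset_stab stab_auto by auto
      then have "\<phi> = r \<otimes>\<^bsub>Aut\<^esub> c \<otimes>\<^bsub>Aut\<^esub> g" using \<phi>(1) s(1) by (simp add: A.m_assoc)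
      moreover have "r \<otimes>\<^bsub>Aut\<^esub> c \<in> Inn W <#>\<^bsub>Aut\<^esub> D"
        unfolding eq[symmetric] by (rule set_mult_memI[OF \<phi>(2) s(2)])
      ultimately show "\<phi> \<in> (Inn W <#>\<^bsub>Aut\<^esub> D) <#>\<^bsub>Aut\<^esub> Gset"
        using set_mult_memI[OF _ s(3)] by simp
    qed
  qed
qed

end

section \<open>The star group\<close>

definition word_of :: "(nat \<times> nat) list \<Rightarrow> nat list" where
  "word_of xs = concat (map (\<lambda>(i, e). concat (replicate e [1, i])) xs)"

lemma word_of_simps [simp]:
  "word_of [] = []" "word_of ((i, e) # xs) = concat (replicate e [1, i]) @ word_of xs"
  by (simp_all add: word_of_def)

lemma replicate_pair_words: "1 \<le> n \<Longrightarrow> i \<in> {2..n} \<Longrightarrow> concat (replicate e [1, i]) \<in> words n"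
  by (induction e) (auto simp: words_def)

lemma word_of_words: "1 \<le> n \<Longrightarrow> reduced n t xs \<Longrightarrow> word_of xs \<in> words n"
proof (induction xs)
  case (Cons c xs)
  obtain i e where c: "c = (i, e)" by fastforce
  with Cons have "concat (replicate e [1, i]) \<in> words n" "word_of xs \<in> words n"
    by (auto simp: reduced_Cons intro!: replicate_pair_words)
  then show ?case using c by (simp add: words_def)
qed (simp add: words_def)

text \<open>The step that recovers a normal form from its word: e copies of [1, i] act as a_i^e and
  prepend the syllable (i, e).\<close>

lemma act_word_of:
  assumes "reduced n t xs" "\<And>i. i \<in> {2..n} \<Longrightarrow> 1 < t i"
  shows "foldr (act t) (word_of xs) ([], b) = (xs, b)"
  using assms(1)
proof (induction xs)
  case (Cons c xs)
  obtain i e where c: "c = (i, e)" by fastforce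
  with Cons have *: "i \<in> {2..n}" "0 < e" "e < t i" "reduced n t xs" "xs = [] \<or> fst (hd xs) \<noteq> i"
    by (auto simp: reduced_Cons)
  then have "foldr (act t) (concat (replicate e [1, i])) (xs, b) = ((mulA t i ^^ e) xs, b)"
    using foldr_replicate_pair[OF *(4,1)] assms(2) by blast
  then show ?case using Cons.IH * c mulA_power[of xs i e t] by simp
qed simp

lemma cls_relator: "r \<in> relators n t \<Longrightarrow> 1 \<le> n \<Longrightarrow> cls n t r = \<one>\<^bsub>starW n t\<^esub>"
  unfolding one_starW by (rule equiv_class_eq[OF weq_equiv weq_relator])

lemma gen_closed: "j \<in> {1..n} \<Longrightarrow> gen n t j \<in> carrier (starW n t)"
  unfolding gen_def by (rule cls_closed) (simp add: words_def)

lemma gen_mult_cls: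
  "j \<in> {1..n} \<Longrightarrow> u \<in> words n \<Longrightarrow> gen n t j \<otimes>\<^bsub>starW n t\<^esub> cls n t u = cls n t (j # u)"
  unfolding gen_def by (subst cls_mult) (auto simp: words_def)

lemma gen_pair_power:
  assumes "1 \<le> n" "i \<in> {2..n}"
  shows "(gen n t 1 \<otimes>\<^bsub>starW n t\<^esub> gen n t i) [^]\<^bsub>starW n t\<^esub> e = cls n t (concat (replicate e [1, i]))"
proof (induction e)
  interpret group "starW n t" by (rule group_starW[OF assms(1)])
  have pair: "gen n t 1 \<otimes>\<^bsub>starW n t\<^esub> gen n t i = cls n t [1, i]"
    unfolding gen_def using assms by (subst cls_mult) (auto simp: words_def)
  case 0
  then show ?case by (simp add: one_starW)
  case (Suc e)
  have "(gen n t 1 \<otimes>\<^bsub>starW n t\<^esub> gen n t i) [^]\<^bsub>starW n t\<^esub> Suc e =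
      (gen n t 1 \<otimes>\<^bsub>starW n t\<^esub> gen n t i) \<otimes>\<^bsub>starW n t\<^esub> (gen n t 1 \<otimes>\<^bsub>starW n t\<^esub> gen n t i) [^]\<^bsub>starW n t\<^esub> e"
    using assms by (intro nat_pow_Suc2 m_closed gen_closed) auto
  also have "\<dots> = cls n t ([1, i] @ concat (replicate e [1, i]))"
    unfolding Suc unfolding pair
    by (rule cls_mult[OF _ replicate_pair_words[OF assms]]) (use assms in \<open>auto simp: words_def\<close>)
  finally show ?case by simp
qed

lemma syl_prod_gen:
  assumes "1 \<le> n" "reduced n t xs"
  shows "syl_prod (starW n t) (gen n t) xs = cls n t (word_of xs)"
  using assms(2)
proof (induction xs)
  case (Cons c xs)
  obtain i e where c: "c = (i, e)" by fastforce
  with Cons have "i \<in> {2..n}" "reduced n t xs" by (auto simp: reduced_Cons)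
  then show ?case
    using Cons.IH assms(1) gen_pair_power[of n i t e] c
    by (simp add: cls_mult replicate_pair_words word_of_words)
qed (simp add: one_starW)

lemma starW_induct:
  assumes "g \<in> carrier (starW n t)" "P \<one>\<^bsub>starW n t\<^esub>"
    "\<And>j g. j \<in> {1..n} \<Longrightarrow> g \<in> carrier (starW n t) \<Longrightarrow> P g \<Longrightarrow> P (gen n t j \<otimes>\<^bsub>starW n t\<^esub> g)"
  shows "P g"
proof -
  obtain u where u: "u \<in> words n" "g = cls n t u" by (rule carrier_starW_E[OF assms(1)])
  have "P (cls n t u)" using u(1)
  proof (induction u)
    case Nil
    then show ?case using assms(2) by (simp add: one_starW)
  next
    case (Cons j u)
    then have j: "j \<in> {1..n}" "u \<in> words n" by (auto simp: words_def)
    then show ?case using assms(3)[OF j(1) cls_closed[OF j(2)]] Cons.IH gen_mult_cls by metis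
  qed
  then show ?thesis using u by simp
qed

lemma starW_nf_unique:
  assumes n: "1 \<le> n" and t: "\<And>i. i \<in> {2..n} \<Longrightarrow> 1 < t i"
    and xs: "reduced n t xs" and ys: "reduced n t ys"
    and eq: "syl_prod (starW n t) (gen n t) xs \<otimes>\<^bsub>starW n t\<^esub> (if b then gen n t 1 else \<one>\<^bsub>starW n t\<^esub>)
      = syl_prod (starW n t) (gen n t) ys \<otimes>\<^bsub>starW n t\<^esub> (if c then gen n t 1 else \<one>\<^bsub>starW n t\<^esub>)"
  shows "xs = ys \<and> b = c"
proof -
  let ?u = "\<lambda>xs b. word_of xs @ (if b then [1] else [])"
  have w: "?u zs b \<in> words n" if "reduced n t zs" for zs b
    using word_of_words[OF n that] n by (simp add: words_def)
  have "syl_prod (starW n t) (gen n t) zs \<otimes>\<^bsub>starW n t\<^esub> (if b then gen n t 1 else \<one>\<^bsub>starW n t\<^esub>)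
      = cls n t (?u zs b)" if "reduced n t zs" for zs b
  proof -
    have s: "(if b then gen n t 1 else \<one>\<^bsub>starW n t\<^esub>) = cls n t (if b then [1] else [])"
      by (simp add: gen_def one_starW)
    have "(if b then [1] else []) \<in> words n" using n by (simp add: words_def)
    then show ?thesis
      unfolding s syl_prod_gen[OF n that] by (rule cls_mult[OF word_of_words[OF n that]])
  qed
  then have "cls n t (?u xs b) = cls n t (?u ys c)" using eq xs ys by simp
  then have "(?u xs b, ?u ys c) \<in> weq n t" using cls_eq_iff[OF w[OF xs] w[OF ys]] by blast
  \<comment> \<open>Both words run from the empty normal form. A trailing [1] acts first and turns
    \<open>False\<close> into \<open>True\<close>, so the flag is read off as well.\<close>
  then have "foldr (act t) (?u xs b) ([], False) = foldr (act t) (?u ys c) ([], False)"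
    by (rule act_weq) (use n t in auto)
  moreover have "foldr (act t) (?u zs b) ([], False) = (zs, b)" if "reduced n t zs" for zs b
    using act_word_of[OF that t] by simp
  ultimately show ?thesis using xs ys by simp
qed

text \<open>Evaluation of words in H sends relators to the identity and is therefore constant on
  classes; \<open>h\<close> evaluates a chosen representative.\<close>

lemma starW_universal:
  fixes H (structure)
  assumes n: "1 \<le> n" and H: "group H"
    and v: "\<And>j. j \<in> {1..n} \<Longrightarrow> v j \<in> carrier H \<and> v j \<otimes> v j = \<one>"
    and rel: "\<And>i. i \<in> {2..n} \<Longrightarrow> (v 1 \<otimes> v i) [^] t i = \<one>"
  shows "\<exists>h \<in> hom (starW n t) H. \<forall>j\<in>{1..n}. h (gen n t j) = v j"
proof -
  interpret group H by (rule H)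
  define f where "f u = foldr (\<lambda>j g. v j \<otimes> g) u \<one>" for u
  have f_closed: "f u \<in> carrier H" if "u \<in> words n" for u
    using that v by (induction u) (auto simp: f_def words_def)
  have f_append: "f (u @ u') = f u \<otimes> f u'" if "u \<in> words n" "u' \<in> words n" for u u'
    using that(1)
  proof (induction u)
    case Nil
    then show ?case using f_closed[OF that(2)] by (simp add: f_def)
  next
    case (Cons j u)
    then have "j \<in> {1..n}" "u \<in> words n" by (auto simp: words_def)
    then show ?case using Cons.IH f_closed[OF that(2)] f_closed[of u] v[of j] by (simp add: f_def m_assoc)
  qed
  have f_pair: "f (concat (replicate e [1, i])) = (v 1 \<otimes> v i) [^] e" if i: "i \<in> {2..n}" for i e
  proof (induction e)
    case (Suc e)
    have c: "v 1 \<in> carrier H" "v i \<in> carrier H" using i n v[of 1] v[of i] by auto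
    have w: "concat (replicate e [1, i]) \<in> words n" "[1, i] \<in> words n"
      using replicate_pair_words[OF n i] i n by (auto simp: words_def)
    have "f (concat (replicate (Suc e) [1, i])) = f ([1, i] @ concat (replicate e [1, i]))" by simp
    also have "\<dots> = (v 1 \<otimes> v i) \<otimes> (v 1 \<otimes> v i) [^] e"
      unfolding f_append[OF w(2,1)] Suc using c by (simp add: f_def)
    finally show ?case using c nat_pow_Suc2[of "v 1 \<otimes> v i" e] by simp
  qed (simp add: f_def)
  have f_relator: "f r = \<one>" if "r \<in> relators n t" for r
    using that f_pair rel v by (auto simp: relators_def f_def)
  have f_step: "f u = f u'" if step: "(u, u') \<in> red_step n t" and u: "u \<in> words n" for u u'
  proof -
    obtain xs r ys where *: "u = xs @ r @ ys" "u' = xs @ ys" "r \<in> relators n t"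
      using step by (auto simp: red_step_def)
    then have w: "xs \<in> words n" "r \<in> words n" "ys \<in> words n" "r @ ys \<in> words n"
      using u by (auto simp: words_def)
    show ?thesis
      unfolding * f_append[OF w(1,4)] f_append[OF w(2,3)] f_append[OF w(1,3)] f_relator[OF *(3)]
      using f_closed w by simp
  qed
  have f_weq: "f u = f u'" if "(u, u') \<in> weq n t" for u u'
  proof -
    have "(u, u') \<in> (red_step n t \<union> (red_step n t)\<inverse>)\<^sup>*" and u: "u \<in> words n"
      using that by (auto simp: weq_def)
    then have "u' \<in> words n \<and> f u = f u'"
    proof induction
      case (step u1 u2)
      then have "u2 \<in> words n" using red_step_words[of _ _ n t] n by blast
      then show ?case using step f_step by (metis Un_iff converseD)
    qed (use u in simp)
    then show ?thesis by simp
  qed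
  define h where "h A = f (SOME a. a \<in> A)" for A
  have h_cls: "h (cls n t u) = f u" if "u \<in> words n" for u
    unfolding h_def using f_weq[OF some_cls(1)[OF that]] by simp
  have "h \<in> hom (starW n t) H"
  proof (rule homI)
    fix x y assume "x \<in> carrier (starW n t)" "y \<in> carrier (starW n t)"
    then obtain u u' where uu: "u \<in> words n" "x = cls n t u" "u' \<in> words n" "y = cls n t u'"
      by (metis carrier_starW_E)
    then show "h x \<in> carrier H" by (simp add: h_cls f_closed)
    have "u @ u' \<in> words n" using uu by (simp add: words_def)
    then show "h (x \<otimes>\<^bsub>starW n t\<^esub> y) = h x \<otimes> h y"
      using uu by (simp add: cls_mult h_cls f_append)
  qed
  moreover have "h (gen n t j) = v j" if "j \<in> {1..n}" for j
    using that v[OF that] unfolding gen_def by (subst h_cls) (auto simp: words_def f_def)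
  ultimately show ?thesis by blast
qed

lemma star_group_starW:
  assumes n: "1 \<le> n" and t: "\<And>i. i \<in> {2..n} \<Longrightarrow> odd (t i) \<and> 1 < t i"
  shows "star_group (starW n t) n t (gen n t)"
proof (intro star_group.intro star_group_axioms.intro)
  show "group (starW n t)" by (rule group_starW[OF n])
  show "gen n t j \<otimes>\<^bsub>starW n t\<^esub> gen n t j = \<one>\<^bsub>starW n t\<^esub>" if j: "j \<in> {1..n}" for j
  proof -
    have "gen n t j \<otimes>\<^bsub>starW n t\<^esub> gen n t j = cls n t ([j] @ [j])"
      unfolding gen_def by (rule cls_mult) (use j in \<open>auto simp: words_def\<close>)
    also have "\<dots> = \<one>\<^bsub>starW n t\<^esub>" by (rule cls_relator[OF _ n]) (use j in \<open>auto simp: relators_def\<close>)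
    finally show ?thesis .
  qed
  show "(gen n t 1 \<otimes>\<^bsub>starW n t\<^esub> gen n t i) [^]\<^bsub>starW n t\<^esub> t i = \<one>\<^bsub>starW n t\<^esub>" if i: "i \<in> {2..n}" for i
    unfolding gen_pair_power[OF n i] by (rule cls_relator[OF _ n]) (use i in \<open>auto simp: relators_def\<close>)
  show "xs = ys \<and> b = c"
    if "reduced n t xs" "reduced n t ys"
      "syl_prod (starW n t) (gen n t) xs \<otimes>\<^bsub>starW n t\<^esub> (if b then gen n t 1 else \<one>\<^bsub>starW n t\<^esub>)
      = syl_prod (starW n t) (gen n t) ys \<otimes>\<^bsub>starW n t\<^esub> (if c then gen n t 1 else \<one>\<^bsub>starW n t\<^esub>)" for xs ys b c
    using starW_nf_unique[OF n _ that] t by blast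
  show "\<exists>h \<in> hom (starW n t) (starW n t). \<forall>j\<in>{1..n}. h (gen n t j) = v j"
    if "\<And>j. j \<in> {1..n} \<Longrightarrow> v j \<in> carrier (starW n t) \<and> v j \<otimes>\<^bsub>starW n t\<^esub> v j = \<one>\<^bsub>starW n t\<^esub>"
      "\<And>i. i \<in> {2..n} \<Longrightarrow> (v 1 \<otimes>\<^bsub>starW n t\<^esub> v i) [^]\<^bsub>starW n t\<^esub> t i = \<one>\<^bsub>starW n t\<^esub>" for v
    using starW_universal[where t = t and v = v, OF n group_starW[where t = t, OF n] that] by blast
qed (use n t gen_closed in \<open>auto intro: starW_induct\<close>)

section \<open>Blocks\<close>

lemma block_Union: "(\<Union>j\<in>{1..l}. block k j) = {2..1 + (\<Sum>r\<in>{1..l}. k r)}"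
proof (induction l)
  case (Suc l)
  have "(\<Union>j\<in>{1..Suc l}. block k j) = {2..1 + (\<Sum>r\<in>{1..l}. k r)} \<union> block k (Suc l)"
    using Suc by (simp add: atLeastAtMostSuc_conv Un_commute)
  also have "block k (Suc l) = {2 + (\<Sum>r\<in>{1..l}. k r)..1 + (\<Sum>r\<in>{1..Suc l}. k r)}"
    by (simp add: block_def atLeastLessThanSuc_atLeastAtMost)
  also have "{2..1 + (\<Sum>r\<in>{1..l}. k r)} \<union> \<dots> = {2..1 + (\<Sum>r\<in>{1..Suc l}. k r)}"
    by auto
  finally show ?case .
qed (auto simp: One_nat_def)

lemma block_less:
  assumes "j < j'" "i \<in> block k j" "i' \<in> block k j'"
  shows "i < i'"
proof -
  have "(\<Sum>r\<in>{1..j}. k r) \<le> (\<Sum>r\<in>{1..<j'}. k r)"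
    using assms(1) by (intro sum_mono2) auto
  then show ?thesis using assms(2,3) by (simp add: block_def)
qed

text \<open>By \<open>block_less\<close> the blocks are disjoint, so the description in
  \<open>tval\<close> has a unique solution.\<close>

lemma tval_block:
  assumes "j \<in> {1..l}" "i \<in> block k j"
  shows "tval l m k i = m j"
proof -
  have "(THE j. j \<in> {1..l} \<and> i \<in> block k j) = j"
  proof (rule the_equality)
    show "j' = j" if "j' \<in> {1..l} \<and> i \<in> block k j'" for j'
      using that assms(2) block_less[of j j' i k i] block_less[of j' j i k i] by (metis less_irrefl nat_neq_iff)
  qed (use assms in blast)
  then show ?thesis by (simp add: tval_def)
qed

theorem theorem4p4:
  fixes n l :: nat and m k :: "nat \<Rightarrow> nat"
  defines "t \<equiv> tval l m k"
  defines "Aut \<equiv> AutW n t"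
  defines "C \<equiv> Cgrp n t"
  defines "Cyc \<equiv> generate Aut {innaut (starW n t) (gen n t 1)}"
  defines "I \<equiv> Inn (starW n t)"
  defines "GA \<equiv> Ggrp n t l k"
  assumes "n \<ge> 3" and "l \<ge> 1"
    and "inj_on m {1..l}"
    and "\<forall>j\<in>{1..l}. odd (m j) \<and> m j \<ge> 3"
    and "\<forall>j\<in>{1..l}. k j > 0"
    and "(\<Sum>j\<in>{1..l}. k j) = n - 1"
    and "\<exists>p i. Factorial_Ring.prime (p::nat) \<and> p mod 4 = 3 \<and> i \<in> {1..l} \<and> p dvd m i"
  shows "(\<exists>D. subgroup D Aut \<and> D \<subseteq> C \<and> D \<inter> Cyc = {\<one>\<^bsub>Aut\<^esub>} \<and> C = D <#>\<^bsub>Aut\<^esub> Cyc)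
    \<and> (\<forall>D. subgroup D Aut \<and> D \<subseteq> C \<and> D \<inter> Cyc = {\<one>\<^bsub>Aut\<^esub>} \<and> C = D <#>\<^bsub>Aut\<^esub> Cyc \<longrightarrow>
          I \<lhd> (Aut\<lparr>carrier := I <#>\<^bsub>Aut\<^esub> C\<rparr>)
        \<and> I \<inter> D = {\<one>\<^bsub>Aut\<^esub>}
        \<and> I <#>\<^bsub>Aut\<^esub> C = I <#>\<^bsub>Aut\<^esub> D
        \<and> (I <#>\<^bsub>Aut\<^esub> D) \<lhd> Aut
        \<and> subgroup GA Aut
        \<and> (I <#>\<^bsub>Aut\<^esub> D) \<inter> GA = {\<one>\<^bsub>Aut\<^esub>}
        \<and> carrier Aut = (I <#>\<^bsub>Aut\<^esub> D) <#>\<^bsub>Aut\<^esub> GA)"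
proof -
  have blocks: "(\<Union>j\<in>{1..l}. block k j) = {2..n}"
    using block_Union[of k l] assms(7,12) by simp
  have t_block: "t i = m j" if "j \<in> {1..l}" "i \<in> block k j" for i j
    unfolding t_def using that by (rule tval_block)
  have t: "odd (t i) \<and> 1 < t i" if i: "i \<in> {2..n}" for i
  proof -
    obtain j where "j \<in> {1..l}" "i \<in> block k j" using i unfolding blocks[symmetric] by blast
    then show ?thesis using t_block assms(10) by fastforce
  qed
  interpret S: star_group "starW n t" n t "gen n t"
    by (rule star_group_starW) (use assms(7) t in auto)
  \<comment> \<open>The m_j are distinct, so the value of t determines the block. This lets
    \<open>Gset\<close>, which does not mention blocks, equal G.\<close>
  have same_block: "i' \<in> block k j"
    if j: "j \<in> {1..l}" "i \<in> block k j" and i': "i' \<in> {2..n}" "t i' = t i" for i i' j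
  proof -
    obtain j' where j': "j' \<in> {1..l}" "i' \<in> block k j'" using i'(1) unfolding blocks[symmetric] by blast
    then have "m j' = m j" using t_block j i'(2) by simp
    then have "j' = j" using assms(9) j(1) j'(1) by (simp add: inj_on_eq_iff)
    then show ?thesis using j' by simp
  qed
  have GA: "GA = S.Gset"
  proof
    show "GA \<subseteq> S.Gset"
    proof
      fix \<phi> assume "\<phi> \<in> GA"
      then obtain \<alpha> where \<phi>: "\<phi> \<in> S.stab" "\<alpha> ` {2..n} = {2..n}" "\<forall>i\<in>{2..n}. \<phi> (gen n t i) = gen n t (\<alpha> i)"
        unfolding GA_def Ggrp_def S.stab_def bij_betw_def by blast
      then have "\<forall>i\<in>{2..n}. \<exists>j\<in>{2..n}. \<phi> (gen n t i) = gen n t j" by blast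
      then show "\<phi> \<in> S.Gset" using \<phi>(1) unfolding S.Gset_def by blast
    qed
    show "S.Gset \<subseteq> GA"
    proof
      fix \<phi> assume \<phi>: "\<phi> \<in> S.Gset"
      obtain \<alpha> where \<alpha>: "bij_betw \<alpha> {2..n} {2..n}"
        "\<forall>i\<in>{2..n}. t (\<alpha> i) = t i \<and> \<phi> (gen n t i) = gen n t (\<alpha> i)"
        using S.Gset_perm[OF \<phi>] by blast
      \<comment> \<open>As \<alpha> preserves t, it maps the block into itself; injectivity and
        finiteness make it onto.\<close>
      have "\<alpha> ` block k j = block k j" if j: "j \<in> {1..l}" for j
      proof (rule endo_inj_surj)
        have sub: "block k j \<subseteq> {2..n}" unfolding blocks[symmetric] using j by blast
        show "finite (block k j)" by (simp add: block_def)
        show "inj_on \<alpha> (block k j)" using \<alpha>(1) sub unfolding bij_betw_def by (metis inj_on_subset)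
        show "\<alpha> ` block k j \<subseteq> block k j"
        proof
          fix x assume "x \<in> \<alpha> ` block k j"
          then obtain i where i: "i \<in> block k j" "x = \<alpha> i" by blast
          then have "i \<in> {2..n}" using sub by blast
          then have "\<alpha> i \<in> {2..n}" "t (\<alpha> i) = t i" using \<alpha> unfolding bij_betw_def by auto
          then show "x \<in> block k j" using same_block[OF j i(1)] i(2) by blast
        qed
      qed
      then show "\<phi> \<in> GA"
        using \<alpha> S.Gset_stab[OF \<phi>] unfolding GA_def Ggrp_def S.stab_def by blast
    qed
  qed
  \<comment> \<open>Existence and uniqueness justify the definite description in
    \<open>theta\<close>.\<close>
  have theta: "S.is_theta i e \<phi> \<longleftrightarrow> \<phi> = theta n t i e" if "i \<in> {2..n}" "coprime e (t i)" for i e \<phi>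
  proof -
    have "theta n t i e = (THE \<phi>. S.is_theta i e \<phi>)" by (simp add: theta_def S.is_theta_def)
    then show ?thesis
      using S.is_theta_exists[OF that] S.is_theta_unique[OF that(1)] by (metis the_equality)
  qed
  have "{theta n t i e | i e. i \<in> {2..n} \<and> 1 \<le> e \<and> e < t i \<and> coprime e (t i)} =
      {\<phi>. \<exists>i e. i \<in> {2..n} \<and> 1 \<le> e \<and> e < t i \<and> coprime e (t i) \<and> S.is_theta i e \<phi>}"
    using theta by blast
  then have C: "C = S.Cset" unfolding C_def Cgrp_def using S.generate_theta by simp
  have Cyc: "Cyc = {\<one>\<^bsub>Aut\<^esub>, innaut (starW n t) (gen n t 1)}"
    unfolding Cyc_def Aut_def by (rule S.generate_iota)
  obtain p i where p: "Factorial_Ring.prime (p::nat)" "p mod 4 = 3" "i \<in> {1..l}" "p dvd m i"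
    using assms(13) by blast
  \<comment> \<open>The first index of block i, which belongs to the block because k_i > 0; there t
    has the value m_i, a multiple of p.\<close>
  have j: "2 + (\<Sum>r\<in>{1..<i}. k r) \<in> block k i"
  proof -
    have "{1..i} = insert i {1..<i}" using p(3) by auto
    moreover have "0 < k i" using p(3) assms(11) by blast
    ultimately show ?thesis by (simp add: block_def Suc_le_eq)
  qed
  then have "2 + (\<Sum>r\<in>{1..<i}. k r) \<in> {2..n}" using p(3) unfolding blocks[symmetric] by blast
  moreover have "p dvd t (2 + (\<Sum>r\<in>{1..<i}. k r))" using t_block[OF p(3) j] p(4) by simp
  ultimately have "\<exists>D. subgroup D Aut \<and> D \<subseteq> C \<and> D \<inter> Cyc = {\<one>\<^bsub>Aut\<^esub>} \<and> C = D <#>\<^bsub>Aut\<^esub> Cyc"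
    unfolding C Cyc Aut_def by (rule S.complement_exists[OF p(1,2)])
  moreover have "I \<lhd> (Aut\<lparr>carrier := I <#>\<^bsub>Aut\<^esub> C\<rparr>)
        \<and> I \<inter> D = {\<one>\<^bsub>Aut\<^esub>}
        \<and> I <#>\<^bsub>Aut\<^esub> C = I <#>\<^bsub>Aut\<^esub> D
        \<and> (I <#>\<^bsub>Aut\<^esub> D) \<lhd> Aut
        \<and> subgroup GA Aut
        \<and> (I <#>\<^bsub>Aut\<^esub> D) \<inter> GA = {\<one>\<^bsub>Aut\<^esub>}
        \<and> carrier Aut = (I <#>\<^bsub>Aut\<^esub> D) <#>\<^bsub>Aut\<^esub> GA"
    if D: "subgroup D Aut \<and> D \<subseteq> C \<and> D \<inter> Cyc = {\<one>\<^bsub>Aut\<^esub>} \<and> C = D <#>\<^bsub>Aut\<^esub> Cyc" for D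
  proof -
    have D': "subgroup D (AutW n t)" "D \<subseteq> S.Cset"
      "D \<inter> {\<one>\<^bsub>AutW n t\<^esub>, innaut (starW n t) (gen n t 1)} = {\<one>\<^bsub>AutW n t\<^esub>}"
      "S.Cset = D <#>\<^bsub>AutW n t\<^esub> {\<one>\<^bsub>AutW n t\<^esub>, innaut (starW n t) (gen n t 1)}"
      using D unfolding C Cyc Aut_def by blast+
    show ?thesis
      unfolding I_def GA C Aut_def
      by (intro conjI S.semidirect_decomposition[OF D'] S.subgroup_Gset)
  qed
  ultimately show ?thesis by blast
qed

end
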